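(* For any non-empty indices $\mathbf{k}$ and $\mathbf{k}'$, $$Z^\star\Big(e_{\mathbf{k}}\,\tilde{\star}\,e_{\mathbf{k}'}-\delta\big(\delta(e_{\mathbf{k}})\,\tilde{\star}\,\delta(e_{\mathbf{k}'})\big)\Big)=0$$ in $\mathcal{A}^{\mathrm{cyc}}$.
   Context: Index: a tuple $\mathbf{k}=(k_1,\dots,k_r)$ of positive integers, with $\mathrm{wt}(\mathbf{k})=k_1+\cdots+k_r$, $\mathrm{dep}(\mathbf{k})=r$. For each prime $p$ let $\zeta_p$ be a primitive $p$-th root of unity, and let $\mathcal{A}^{\mathrm{cyc}}=\big(\prod_{p}\mathbb{Z}[\zeta_p]/(p)\big)/\big(\bigoplus_{p}\mathbb{Z}[\zeta_p]/(p)\big)$ ($p$ over all primes), a $\mathbb{Q}$-algebra. With $[m]_q=\frac{1-q^m}{1-q}$ and $z_n^\star(\mathbf{k};q)=\sum_{n>m_1\ge\cdots\ge m_r>0}\prod_{j}q^{(k_j-1)m_j}[m_j]_q^{-k_j}$ (and $z_n^\star(\emptyset;q)=1$), the values $z_p^\star(\mathbf{k};\zeta_p)$ lie in $\mathbb{Z}[\zeta_p]$, and $Z^\star(\mathbf{k})=(z_p^\star(\mathbf{k};\zeta_p)\bmod(p))_p\in\mathcal{A}^{\mathrm{cyc}}$. Let $\mathfrak{H}^1=\mathbb{Q}\langle e_1,e_2,\ldots\rangle$ be the noncommutative polynomial algebra with basis $e_{\mathbf{k}}=e_{k_1}\cdots e_{k_r}$ ($e_\emptyset=1$). Denote also by $Z^\star:\mathfrak{H}^1\to\mathcal{A}^{\mathrm{cyc}}$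 the $\mathbb{Q}$-linear map $e_{\mathbf{k}}\mapsto Z^\star(\mathbf{k})$. The product $\star$ on $\mathfrak{H}^1$ is $\mathbb{Q}$-bilinear with $1\star w=w\star1=w$ and $e_kw\star e_{k'}w'=e_k(w\star e_{k'}w')+e_{k'}(e_kw\star w')-e_{k+k'}(w\star w')$. Let $\mathcal{C}=\mathbb{Q}[\hbar]$ and $\widehat{\mathfrak{H}}^1=\mathcal{C}\otimes_{\mathbb{Q}}\mathfrak{H}^1$. The $\mathcal{C}$-bilinear product $\star_q$ on $\widehat{\mathfrak{H}}^1$ is given by $1\star_qw=w\star_q1=w$ and $$e_{k_1}v\star_qe_{k_2}w=e_{k_1}(v\star_qe_{k_2}w)+e_{k_2}(e_{k_1}v\star_qw)-(e_{k_1+k_2}+\hbar\,e_{k_1+k_2-1})(v\star_qw).$$ Let $L^\star:\mathfrak{H}^1\to\mathfrak{H}^1$ be the $\mathbb{Q}$-linear map $L^\star(e_{\mathbf{k}})=\frac{2}{2\,\mathrm{dep}(\mathbf{k})-1}\,e_1\star e_{\mathbf{k}}$, let $\rho^\star:\widehat{\mathfrak{H}}^1\to\mathfrak{H}^1$ be the $\mathbb{Q}$-linear map $\rho^\star(\hbar^kw)=(L^\star)^k(w)$ ($k\ge0$, $w\in\mathfrak{H}^1$), and set $v\,\tilde{\star}\,w=\rho^\star(v\star_qw)$ for $v,w\in\mathfrak{H}^1$. (This product respects weight, so the product of two elements of positive weight has no constant term.) The reverse of $\mathbf{k}$ is $\overline{\mathbf{k}}=(k_r,\dots,k_1)$. The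 Hoffman dual $\mathbf{k}^\vee$ of a non-empty index: identify $e_k=e_0^{k-1}e_1$ in $\mathbb{Q}\langle e_0,e_1\rangle$, let $\tau$ be the algebra automorphism exchanging $e_0$ and $e_1$, write $e_{\mathbf{k}}=w'e_1$; then $e_{\mathbf{k}^\vee}=\tau(w')e_1$. The $\mathbb{Q}$-linear map $\delta$, on the span of all $e_{\mathbf{k}}$ with $\mathbf{k}$ non-empty, is $\delta(e_{\mathbf{k}})=(-1)^{\mathrm{wt}(\mathbf{k})+1}e_{\overline{\mathbf{k}^\vee}}$. *)

theory Defs
  imports
    "HOL-Computational_Algebra.Polynomial"
    "HOL-Computational_Algebra.Primes"
    "HOL-Library.Poly_Mapping"
    "HOL-Algebra.QuotRing"
begin

section \<open>Indices\<close>

definition is_index :: "nat list \<Rightarrow> bool" where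
  "is_index ks \<longleftrightarrow> (\<forall>k\<in>set ks. k > 0)"

abbreviation wt :: "nat list \<Rightarrow> nat" where
  "wt ks \<equiv> sum_list ks"

abbreviation dep :: "nat list \<Rightarrow> nat" where
  "dep ks \<equiv> length ks"


section \<open>The ring \<open>\<A>\<^sup>c\<^sup>y\<^sup>c\<close>\<close>

definition primitive_root_of_unity :: "nat \<Rightarrow> complex \<Rightarrow> bool" where
  "primitive_root_of_unity n z \<longleftrightarrow> n > 0 \<and> z ^ n = 1 \<and> (\<forall>m. 0 < m \<and> m < n \<longrightarrow> z ^ m \<noteq> 1)"

text \<open>The subring $\mathbb{Z}[z]$ of the complex numbers.\<close>

definition Z_adjoin :: "complex \<Rightarrow> complex ring" where
  "Z_adjoin z = \<lparr>carrier = {poly (map_poly of_int P) z | P :: int poly. True},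
     mult = (*), one = 1, zero = 0, add = (+)\<rparr>"

definition product_ring :: "'i set \<Rightarrow> ('i \<Rightarrow> ('a, 'b) ring_scheme) \<Rightarrow> ('i \<Rightarrow> 'a) ring" where
  "product_ring I R = \<lparr>carrier = (\<Pi>\<^sub>E i\<in>I. carrier (R i)),
     mult = (\<lambda>x y. \<lambda>i\<in>I. x i \<otimes>\<^bsub>R i\<^esub> y i),
     one = (\<lambda>i\<in>I. \<one>\<^bsub>R i\<^esub>),
     zero = (\<lambda>i\<in>I. \<zero>\<^bsub>R i\<^esub>),
     add = (\<lambda>x y. \<lambda>i\<in>I. x i \<oplus>\<^bsub>R i\<^esub> y i)\<rparr>"

definition direct_sum :: "'i set \<Rightarrow> ('i \<Rightarrow> ('a, 'b) ring_scheme) \<Rightarrow> ('i \<Rightarrow> 'a) set" where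
  "direct_sum I R = {x \<in> carrier (product_ring I R). finite {i \<in> I. x i \<noteq> \<zero>\<^bsub>R i\<^esub>}}"

definition principal_p :: "(nat \<Rightarrow> complex) \<Rightarrow> nat \<Rightarrow> complex set" where
  "principal_p \<zeta> p = PIdl\<^bsub>Z_adjoin (\<zeta> p)\<^esub> (of_nat p)"

definition residue_p :: "(nat \<Rightarrow> complex) \<Rightarrow> nat \<Rightarrow> complex set ring" where
  "residue_p \<zeta> p = Z_adjoin (\<zeta> p) Quot principal_p \<zeta> p"

text \<open>The parameter \<open>\<zeta>\<close> is the chosen family of primitive \<open>p\<close>-th roots of unity; its values
  at non-primes play no role.\<close>

definition Acyc :: "(nat \<Rightarrow> complex) \<Rightarrow> (nat \<Rightarrow> complex set) set ring" where
  "Acyc \<zeta> = product_ring {p. prime p} (residue_p \<zeta>) Quot direct_sum {p. prime p} (residue_p \<zeta>)"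

text \<open>Scalar multiplication by a rational number in a ring in which the positive integers are
  invertible, such as \<open>Acyc \<zeta>\<close> (see \<open>Acyc_of_nat_Units\<close>).\<close>

definition rat_smult :: "('a, 'b) ring_scheme \<Rightarrow> rat \<Rightarrow> 'a \<Rightarrow> 'a" where
  "rat_smult R r x = (case quotient_of r of (a, b) \<Rightarrow>
     ([a] \<cdot>\<^bsub>R\<^esub> \<one>\<^bsub>R\<^esub> \<otimes>\<^bsub>R\<^esub> inv\<^bsub>R\<^esub> ([b] \<cdot>\<^bsub>R\<^esub> \<one>\<^bsub>R\<^esub>)) \<otimes>\<^bsub>R\<^esub> x)"


subsection \<open>Well-definedness\<close>

lemma map_poly_of_int_add:
  "map_poly (of_int :: int \<Rightarrow> complex) (P + Q) = map_poly of_int P + map_poly of_int Q"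
  by (rule poly_eqI) (simp add: coeff_map_poly)

lemma map_poly_of_int_minus:
  "map_poly (of_int :: int \<Rightarrow> complex) (- P) = - map_poly of_int P"
  by (rule poly_eqI) (simp add: coeff_map_poly)

lemma map_poly_of_int_mult:
  "map_poly (of_int :: int \<Rightarrow> complex) (P * Q) = map_poly of_int P * map_poly of_int Q"
  by (rule poly_eqI) (simp add: coeff_map_poly coeff_mult)

lemma Z_adjoin_memI: "x = poly (map_poly of_int P) z \<Longrightarrow> x \<in> carrier (Z_adjoin z)"
  by (auto simp: Z_adjoin_def)

lemma Z_adjoin_memE:
  assumes "x \<in> carrier (Z_adjoin z)"
  obtains P where "x = poly (map_poly of_int P) z"
  using assms by (auto simp: Z_adjoin_def)

lemma Z_adjoin_add: "x \<in> carrier (Z_adjoin z) \<Longrightarrow> y \<in> carrier (Z_adjoin z) \<Longrightarrow> x + y \<in> carrier (Z_adjoin z)"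
  by (metis Z_adjoin_memE Z_adjoin_memI map_poly_of_int_add poly_add)

lemma Z_adjoin_mult: "x \<in> carrier (Z_adjoin z) \<Longrightarrow> y \<in> carrier (Z_adjoin z) \<Longrightarrow> x * y \<in> carrier (Z_adjoin z)"
  by (metis Z_adjoin_memE Z_adjoin_memI map_poly_of_int_mult poly_mult)

lemma Z_adjoin_uminus: "x \<in> carrier (Z_adjoin z) \<Longrightarrow> - x \<in> carrier (Z_adjoin z)"
  by (metis Z_adjoin_memE Z_adjoin_memI map_poly_of_int_minus poly_minus)

lemma Z_adjoin_of_int: "of_int n \<in> carrier (Z_adjoin z)"
  by (rule Z_adjoin_memI[where P = "[:n:]"]) (simp add: map_poly_pCons)

lemma Z_adjoin_of_nat: "of_nat n \<in> carrier (Z_adjoin z)"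
  using Z_adjoin_of_int[of "int n"] by simp

lemma Z_adjoin_0: "0 \<in> carrier (Z_adjoin z)" and Z_adjoin_1: "1 \<in> carrier (Z_adjoin z)"
  using Z_adjoin_of_int[of 0] Z_adjoin_of_int[of 1] by simp_all

lemma Z_adjoin_gen: "z \<in> carrier (Z_adjoin z)"
  by (rule Z_adjoin_memI[where P = "[:0, 1:]"]) (simp add: map_poly_pCons)

lemma Z_adjoin_simps [simp]:
  "mult (Z_adjoin z) = (*)" "one (Z_adjoin z) = 1" "zero (Z_adjoin z) = 0" "add (Z_adjoin z) = (+)"
  by (simp_all add: Z_adjoin_def)

lemma Z_adjoin_cring: "cring (Z_adjoin z)"
proof (rule cringI)
  show "abelian_group (Z_adjoin z)"
    by (rule abelian_groupI)
      (auto simp: Z_adjoin_add Z_adjoin_0 intro!: bexI[of _ "- x" for x] Z_adjoin_uminus)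
  show "comm_monoid (Z_adjoin z)"
    by (rule comm_monoidI) (auto simp: Z_adjoin_mult Z_adjoin_1)
qed (simp add: algebra_simps)

lemma product_ring_cring:
  assumes "\<And>i. i \<in> I \<Longrightarrow> cring (R i)"
  shows "cring (product_ring I R)"
proof -
  have ring: "ring (R i)" if "i \<in> I" for i
    using assms[OF that] by (simp add: cring_def)
  have sr: "semiring (R i)" if "i \<in> I" for i
  proof -
    interpret ring "R i" by (rule ring) fact
    show ?thesis by (rule semiring_axioms)
  qed
  have ag: "abelian_group (R i)" if "i \<in> I" for i
    using ring[OF that] by (simp add: ring_def)
  have am: "abelian_monoid (R i)" if "i \<in> I" for i
    using ag[OF that] by (simp add: abelian_group_def)
  have cm: "comm_monoid (R i)" if "i \<in> I" for i
    using assms[OF that] by (simp add: cring_def)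
  have m: "Group.monoid (R i)" if "i \<in> I" for i
    using cm[OF that] by (simp add: comm_monoid_def)
  show ?thesis
  proof (rule cringI)
    show "abelian_group (product_ring I R)"
    proof (rule abelian_groupI)
      fix x assume x: "x \<in> carrier (product_ring I R)"
      show "\<exists>y\<in>carrier (product_ring I R). y \<oplus>\<^bsub>product_ring I R\<^esub> x = \<zero>\<^bsub>product_ring I R\<^esub>"
        using x
        by (intro bexI[of _ "\<lambda>i\<in>I. \<ominus>\<^bsub>R i\<^esub> x i"])
          (auto simp: product_ring_def fun_eq_iff PiE_iff restrict_def extensional_def
            intro!: abelian_group.a_inv_closed abelian_group.l_neg ag)
    qed (auto simp: product_ring_def fun_eq_iff PiE_iff restrict_def extensional_def
          intro!: abelian_monoid.a_closed abelian_monoid.zero_closed abelian_monoid.a_assoc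
            abelian_monoid.a_comm abelian_monoid.l_zero am)
    show "comm_monoid (product_ring I R)"
      by (rule comm_monoidI)
        (auto simp: product_ring_def fun_eq_iff PiE_iff restrict_def extensional_def
          intro!: monoid.m_closed monoid.one_closed monoid.m_assoc comm_monoid.m_comm
            monoid.l_one m cm)
  qed (auto simp: product_ring_def fun_eq_iff PiE_iff restrict_def intro!: semiring.l_distr sr)
qed

lemma direct_sum_ideal:
  assumes "\<And>i. i \<in> I \<Longrightarrow> cring (R i)"
  shows "ideal (direct_sum I R) (product_ring I R)"
proof -
  let ?P = "product_ring I R"
  interpret P: cring ?P
    using assms by (rule product_ring_cring)
  have ring: "ring (R i)" if "i \<in> I" for i
    using assms[OF that] by (simp add: cring_def)
  have fin: "finite {i \<in> I. z i \<noteq> \<zero>\<^bsub>R i\<^esub>}"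
    if "finite {i \<in> I. x i \<noteq> \<zero>\<^bsub>R i\<^esub>}" "finite {i \<in> I. y i \<noteq> \<zero>\<^bsub>R i\<^esub>}"
      "\<And>i. i \<in> I \<Longrightarrow> x i = \<zero>\<^bsub>R i\<^esub> \<Longrightarrow> y i = \<zero>\<^bsub>R i\<^esub> \<Longrightarrow> z i = \<zero>\<^bsub>R i\<^esub>"
    for x y z
    by (rule finite_subset[OF _ finite_UnI[OF that(1,2)]]) (use that(3) in auto)
  have comp: "x i \<in> carrier (R i)" if "x \<in> carrier ?P" "i \<in> I" for x i
    using that by (auto simp: product_ring_def)
  have ainv: "(\<ominus>\<^bsub>?P\<^esub> x) i = \<ominus>\<^bsub>R i\<^esub> x i" if "x \<in> carrier ?P" "i \<in> I" for x i
  proof -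
    interpret ring "R i" by (rule ring) fact
    have "(\<ominus>\<^bsub>?P\<^esub> x \<oplus>\<^bsub>?P\<^esub> x) i = \<zero>\<^bsub>?P\<^esub> i"
      using that P.l_neg by simp
    then have "(\<ominus>\<^bsub>?P\<^esub> x) i \<oplus>\<^bsub>R i\<^esub> x i = \<zero>\<^bsub>R i\<^esub>"
      using that(2) by (simp add: product_ring_def)
    then show ?thesis
      using comp[OF that] comp[OF P.a_inv_closed[OF that(1)] that(2)] minus_equality by simp
  qed
  show ?thesis
  proof (rule idealI)
    show "subgroup (direct_sum I R) (add_monoid ?P)"
    proof (rule P.add.subgroupI)
      show "direct_sum I R \<subseteq> carrier ?P"
        by (auto simp: direct_sum_def)
      have "\<zero>\<^bsub>?P\<^esub> \<in> direct_sum I R"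
        by (auto simp: direct_sum_def) (simp add: product_ring_def)
      then show "direct_sum I R \<noteq> {}" by blast
      fix x assume x: "x \<in> direct_sum I R"
      have "(\<ominus>\<^bsub>?P\<^esub> x) i = \<zero>\<^bsub>R i\<^esub>" if "i \<in> I" "x i = \<zero>\<^bsub>R i\<^esub>" for i
      proof -
        interpret ring "R i" by (rule ring) fact
        show ?thesis using ainv[of x i] that x by (auto simp: direct_sum_def)
      qed
      then show "\<ominus>\<^bsub>?P\<^esub> x \<in> direct_sum I R"
        using x fin[of x x "\<ominus>\<^bsub>?P\<^esub> x"] by (auto simp: direct_sum_def)
    next
      fix x y assume x: "x \<in> direct_sum I R" and y: "y \<in> direct_sum I R"
      have "(x \<oplus>\<^bsub>?P\<^esub> y) i = \<zero>\<^bsub>R i\<^esub>"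
        if "i \<in> I" "x i = \<zero>\<^bsub>R i\<^esub>" "y i = \<zero>\<^bsub>R i\<^esub>" for i
      proof -
        interpret ring "R i" by (rule ring) fact
        show ?thesis using that by (simp add: product_ring_def)
      qed
      then show "x \<oplus>\<^bsub>?P\<^esub> y \<in> direct_sum I R"
        using x y fin[of x y "x \<oplus>\<^bsub>?P\<^esub> y"] by (auto simp: direct_sum_def)
    qed
    fix a x assume a: "a \<in> direct_sum I R" and x: "x \<in> carrier ?P"
    have "(x \<otimes>\<^bsub>?P\<^esub> a) i = \<zero>\<^bsub>R i\<^esub>" if "i \<in> I" "a i = \<zero>\<^bsub>R i\<^esub>" for i
    proof -
      interpret ring "R i" by (rule ring) fact
      show ?thesis using that comp[OF x] by (simp add: product_ring_def)
    qed
    then show *: "x \<otimes>\<^bsub>?P\<^esub> a \<in> direct_sum I R"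
      using a x fin[of a a "x \<otimes>\<^bsub>?P\<^esub> a"] by (auto simp: direct_sum_def)
    then show "a \<otimes>\<^bsub>?P\<^esub> x \<in> direct_sum I R"
      using a x by (simp add: direct_sum_def P.m_comm)
  qed (rule P.ring_axioms)
qed

lemma principal_p_ideal: "ideal (principal_p \<zeta> p) (Z_adjoin (\<zeta> p))"
  unfolding principal_p_def by (rule cring.cgenideal_ideal[OF Z_adjoin_cring Z_adjoin_of_nat])

lemma residue_p_cring: "cring (residue_p \<zeta> p)"
  unfolding residue_p_def by (rule ideal.quotient_is_cring[OF principal_p_ideal Z_adjoin_cring])

lemma Acyc_cring: "cring (Acyc \<zeta>)"
  unfolding Acyc_def
  by (intro ideal.quotient_is_cring direct_sum_ideal product_ring_cring residue_p_cring)

lemma (in ideal) quotient_of_nat: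
  "[n] \<cdot>\<^bsub>R Quot I\<^esub> \<one>\<^bsub>R Quot I\<^esub> = I +> ([(n::nat)] \<cdot>\<^bsub>R\<^esub> \<one>)"
proof -
  interpret Q: ring "R Quot I" by (rule quotient_is_ring)
  interpret h: ring_hom_ring R "R Quot I" "(+>) I" by (rule rcos_ring_hom_ring)
  show ?thesis
  proof (induction n)
    case 0
    show ?case using h.hom_zero by simp
  next
    case (Suc n)
    then show ?case using h.hom_one by simp
  qed
qed

lemma Acyc_of_nat_Units:
  assumes "n > 0"
  shows "[(n::nat)] \<cdot>\<^bsub>Acyc \<zeta>\<^esub> \<one>\<^bsub>Acyc \<zeta>\<^esub> \<in> Units (Acyc \<zeta>)"
proof -
  let ?I = "{p::nat. prime p}"
  let ?P = "product_ring ?I (residue_p \<zeta>)" and ?D = "direct_sum ?I (residue_p \<zeta>)"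
  define cls where "cls p m = principal_p \<zeta> p +>\<^bsub>Z_adjoin (\<zeta> p)\<^esub> (of_int m)" for p m
  interpret P: cring ?P by (rule product_ring_cring) (rule residue_p_cring)
  interpret D: ideal ?D ?P by (rule direct_sum_ideal) (rule residue_p_cring)
  interpret A: cring "Acyc \<zeta>" by (rule Acyc_cring)
  interpret h: ring_hom_ring ?P "Acyc \<zeta>" "(+>\<^bsub>?P\<^esub>) ?D"
    unfolding Acyc_def by (rule D.rcos_ring_hom_ring)
  have cls_hom: "(+>\<^bsub>Z_adjoin (\<zeta> p)\<^esub>) (principal_p \<zeta> p) \<in> ring_hom (Z_adjoin (\<zeta> p)) (residue_p \<zeta> p)" for p
    unfolding residue_p_def by (rule ideal.rcos_ring_hom[OF principal_p_ideal])
  have cls_carrier: "cls p m \<in> carrier (residue_p \<zeta> p)" for p m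
    unfolding cls_def by (rule ring_hom_closed[OF cls_hom Z_adjoin_of_int])
  have cls_add: "cls p a \<oplus>\<^bsub>residue_p \<zeta> p\<^esub> cls p b = cls p (a + b)" for p a b
    using ring_hom_add[OF cls_hom Z_adjoin_of_int Z_adjoin_of_int, of p a b]
    by (simp add: cls_def)
  have cls_mult: "cls p a \<otimes>\<^bsub>residue_p \<zeta> p\<^esub> cls p b = cls p (a * b)" for p a b
    using ring_hom_mult[OF cls_hom Z_adjoin_of_int Z_adjoin_of_int, of p a b]
    by (simp add: cls_def)
  have cls_1: "cls p 1 = \<one>\<^bsub>residue_p \<zeta> p\<^esub>" for p
    using ring_hom_one[OF cls_hom, of p] by (simp add: cls_def)
  have cls_eq0: "cls p (int p * c) = \<zero>\<^bsub>residue_p \<zeta> p\<^esub>" for p c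
  proof -
    interpret J: ideal "principal_p \<zeta> p" "Z_adjoin (\<zeta> p)" by (rule principal_p_ideal)
    have "of_int (int p * c) \<in> principal_p \<zeta> p"
      unfolding principal_p_def cgenideal_def using Z_adjoin_of_int[of c "\<zeta> p"]
      by (auto intro!: exI[of _ "of_int c"])
    then show ?thesis
      unfolding cls_def using J.a_rcos_const by (simp add: residue_p_def FactRing_def)
  qed
  have cls_0: "cls p 0 = \<zero>\<^bsub>residue_p \<zeta> p\<^esub>" for p
    using cls_eq0[of p 0] by simp
  have nat_P: "[(k::nat)] \<cdot>\<^bsub>?P\<^esub> \<one>\<^bsub>?P\<^esub> = (\<lambda>p\<in>?I. cls p (int k))" for k
  proof (induction k)
    case 0
    show ?case by (simp add: cls_0) (simp add: product_ring_def)
  next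
    case (Suc k)
    have "[Suc k] \<cdot>\<^bsub>?P\<^esub> \<one>\<^bsub>?P\<^esub> = [k] \<cdot>\<^bsub>?P\<^esub> \<one>\<^bsub>?P\<^esub> \<oplus>\<^bsub>?P\<^esub> \<one>\<^bsub>?P\<^esub>"
      by simp
    also have "\<dots> = (\<lambda>p\<in>?I. cls p (int (Suc k)))"
      unfolding Suc by (auto simp: product_ring_def fun_eq_iff cls_add cls_1[symmetric] add.commute)
    finally show ?case .
  qed
  have "\<exists>m. p dvd n \<or> (\<exists>c. int n * m = 1 + int p * c)" if "prime p" for p
  proof (cases "p dvd n")
    case False
    then have "coprime (int n) (int p)"
      using prime_imp_coprime[OF that False] by (simp add: coprime_commute)
    then obtain x y where "x * int n + y * int p = 1"
      using bezout_int[of "int n" "int p"] by (auto simp: coprime_iff_gcd_eq_1)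
    then have "int n * x = 1 + int p * (- y)" by (simp add: algebra_simps)
    then show ?thesis by blast
  qed auto
  then obtain m where m: "\<And>p. prime p \<Longrightarrow> \<not> p dvd n \<Longrightarrow> \<exists>c. int n * m p = 1 + int p * c"
    by metis
  define x where "x = (\<lambda>p\<in>?I. cls p (int n))"
  define y where "y = (\<lambda>p\<in>?I. cls p (m p))"
  have xP: "x \<in> carrier ?P" and yP: "y \<in> carrier ?P"
    by (auto simp: x_def y_def product_ring_def cls_carrier)
  have "x \<otimes>\<^bsub>?P\<^esub> y \<ominus>\<^bsub>?P\<^esub> \<one>\<^bsub>?P\<^esub> \<in> ?D"
  proof -
    define w where "w = (\<lambda>p\<in>?I. cls p (int n * m p - 1))"
    have wP: "w \<in> carrier ?P" by (auto simp: w_def product_ring_def cls_carrier)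
    have "w \<oplus>\<^bsub>?P\<^esub> \<one>\<^bsub>?P\<^esub> = x \<otimes>\<^bsub>?P\<^esub> y"
      by (auto simp: w_def x_def y_def product_ring_def fun_eq_iff cls_mult cls_1[symmetric] cls_add)
    then have "x \<otimes>\<^bsub>?P\<^esub> y \<ominus>\<^bsub>?P\<^esub> \<one>\<^bsub>?P\<^esub> = w"
      using wP by (metis P.add.inv_solve_right' P.minus_eq P.m_closed P.one_closed xP yP)
    moreover have "w p = \<zero>\<^bsub>residue_p \<zeta> p\<^esub>" if "prime p" "\<not> p dvd n" for p
      using m[OF that] that by (auto simp: w_def cls_eq0)
    then have "{p \<in> ?I. w p \<noteq> \<zero>\<^bsub>residue_p \<zeta> p\<^esub>} \<subseteq> {..n}"
      using assms by (auto dest: dvd_imp_le)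
    then have "finite {p \<in> ?I. w p \<noteq> \<zero>\<^bsub>residue_p \<zeta> p\<^esub>}"
      by (rule finite_subset) simp
    with wP have "w \<in> ?D"
      unfolding direct_sum_def by (intro CollectI conjI)
    ultimately show ?thesis by (simp only:)
  qed
  then have "?D +>\<^bsub>?P\<^esub> (x \<otimes>\<^bsub>?P\<^esub> y) = ?D +>\<^bsub>?P\<^esub> \<one>\<^bsub>?P\<^esub>"
    using P.quotient_eq_iff_same_a_r_cos[OF D.ideal_axioms, of "x \<otimes>\<^bsub>?P\<^esub> y" "\<one>\<^bsub>?P\<^esub>"] xP yP
    by (metis P.m_closed P.one_closed)
  then have "(?D +>\<^bsub>?P\<^esub> x) \<otimes>\<^bsub>Acyc \<zeta>\<^esub> (?D +>\<^bsub>?P\<^esub> y) = \<one>\<^bsub>Acyc \<zeta>\<^esub>"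
    using h.hom_mult[OF xP yP] h.hom_one by (simp only:)
  moreover have "[n] \<cdot>\<^bsub>Acyc \<zeta>\<^esub> \<one>\<^bsub>Acyc \<zeta>\<^esub> = ?D +>\<^bsub>?P\<^esub> x"
    unfolding Acyc_def x_def D.quotient_of_nat nat_P ..
  ultimately show ?thesis
    using h.hom_closed[OF xP] h.hom_closed[OF yP] A.m_comm unfolding Units_def by force
qed


section \<open>The values \<open>Z\<^sup>\<star>\<close> on indices\<close>

definition q_int :: "complex \<Rightarrow> nat \<Rightarrow> complex" where
  "q_int q m = (1 - q ^ m) / (1 - q)"

definition z_star :: "nat \<Rightarrow> nat list \<Rightarrow> complex \<Rightarrow> complex" where
  "z_star n ks q =
     (\<Sum>ms | length ms = dep ks \<and> set ms \<subseteq> {0<..<n} \<and> sorted_wrt (\<ge>) ms.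
        \<Prod>j<dep ks. q ^ ((ks ! j - 1) * ms ! j) / q_int q (ms ! j) ^ (ks ! j))"

lemma Z_adjoin_power: "x \<in> carrier (Z_adjoin z) \<Longrightarrow> x ^ n \<in> carrier (Z_adjoin z)"
  by (induction n) (simp_all add: Z_adjoin_1 Z_adjoin_mult)

lemma z_star_in_Z_adjoin:
  assumes "prime p" and "primitive_root_of_unity p z"
  shows "z_star p ks z \<in> carrier (Z_adjoin z)"
proof -
  let ?C = "carrier (Z_adjoin z)"
  have sum_mem: "sum f A \<in> ?C" if "\<And>a. a \<in> A \<Longrightarrow> f a \<in> ?C" for f :: "'i \<Rightarrow> complex" and A
    using that by (induction A rule: infinite_finite_induct) (auto simp: Z_adjoin_0 Z_adjoin_add)
  have prod_mem: "prod f A \<in> ?C" if "\<And>a. a \<in> A \<Longrightarrow> f a \<in> ?C" for f :: "'i \<Rightarrow> complex" and A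
    using that by (induction A rule: infinite_finite_induct) (auto simp: Z_adjoin_1 Z_adjoin_mult)
  have zp: "z ^ p = 1" using assms(2) by (simp add: primitive_root_of_unity_def)
  have inv_mem: "1 / q_int z m \<in> ?C" if "m \<in> {0<..<p}" for m
  proof -
    have "\<not> p dvd m" using that by (auto dest: dvd_imp_le)
    then obtain x y where xy: "m * x = Suc (p * y)"
      using bezout_prime[OF assms(1)] by blast
    have zm: "z ^ m \<noteq> 1" using that assms(2) by (auto simp: primitive_root_of_unity_def)
    have "z ^ (m * x) = z"
      unfolding xy by (simp add: power_mult zp)
    then have "1 - z = 1 - (z ^ m) ^ x" by (simp add: power_mult)
    also have "\<dots> = (1 - z ^ m) * (\<Sum>i<x. (z ^ m) ^ i)" by (rule one_diff_power_eq)
    finally have "(1 - z) / (1 - z ^ m) = (\<Sum>i<x. (z ^ m) ^ i)"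
      using zm by simp
    then have "1 / q_int z m = (\<Sum>i<x. (z ^ m) ^ i)"
      by (simp add: q_int_def)
    then show ?thesis by (simp add: sum_mem Z_adjoin_power Z_adjoin_gen)
  qed
  have div: "x / q_int z m ^ k = x * (1 / q_int z m) ^ k" for x m k
    by (simp add: power_one_over)
  have ms: "ms ! j \<in> {0<..<p}" if "length ms = dep ks" "set ms \<subseteq> {0<..<p}" "j < dep ks" for ms j
    using that by (metis nth_mem subsetD)
  show ?thesis
    unfolding z_star_def
  proof (intro sum_mem prod_mem)
    fix ms j
    assume "ms \<in> {ms. length ms = dep ks \<and> set ms \<subseteq> {0<..<p} \<and> sorted_wrt (\<ge>) ms}"
      and "j \<in> {..<dep ks}"
    then have "ms ! j \<in> {0<..<p}" using ms by simp
    then have "(1 / q_int z (ms ! j)) ^ (ks ! j) \<in> ?C"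
      by (intro Z_adjoin_power inv_mem)
    then show "z ^ ((ks ! j - 1) * ms ! j) / q_int z (ms ! j) ^ (ks ! j) \<in> ?C"
      unfolding div by (rule Z_adjoin_mult[OF Z_adjoin_power[OF Z_adjoin_gen]])
  qed
qed

definition Z_star :: "(nat \<Rightarrow> complex) \<Rightarrow> nat list \<Rightarrow> (nat \<Rightarrow> complex set) set" where
  "Z_star \<zeta> ks =
     direct_sum {p. prime p} (residue_p \<zeta>) +>\<^bsub>product_ring {p. prime p} (residue_p \<zeta>)\<^esub>
       (\<lambda>p\<in>{p. prime p}. principal_p \<zeta> p +>\<^bsub>Z_adjoin (\<zeta> p)\<^esub> z_star p ks (\<zeta> p))"


section \<open>The algebra \<open>\<HH>\<^sup>1\<close>\<close>

text \<open>With concatenation as addition, words form the free monoid, and \<open>nat list \<Rightarrow>\<^sub>0 'c\<close> with the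
  convolution product of \<^theory>\<open>HOL-Library.Poly_Mapping\<close> is the free associative algebra over
  \<open>'c\<close> on the letters \<open>e\<^sub>0, e\<^sub>1, e\<^sub>2, \<dots>\<close>. The algebra $\mathfrak{H}^1$ is the subalgebra
  spanned by the words satisfying \<^const>\<open>is_index\<close>; all maps below are only of interest there.\<close>

instantiation list :: (type) monoid_add
begin

definition zero_list :: "'a list" where "zero_list = []"

definition plus_list :: "'a list \<Rightarrow> 'a list \<Rightarrow> 'a list" where "plus_list = (@)"

instance by standard (simp_all add: zero_list_def plus_list_def)

end

type_synonym H1 = "nat list \<Rightarrow>\<^sub>0 rat"

type_synonym H1hat = "nat list \<Rightarrow>\<^sub>0 rat poly"

definition word :: "nat list \<Rightarrow> nat list \<Rightarrow>\<^sub>0 'c::zero_neq_one" where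
  "word ks = Poly_Mapping.single ks 1"

definition scale :: "'c::comm_ring_1 \<Rightarrow> ('a \<Rightarrow>\<^sub>0 'c) \<Rightarrow> ('a \<Rightarrow>\<^sub>0 'c)" where
  "scale c w = Poly_Mapping.map ((*) c) w"

definition linear_ext :: "('a \<Rightarrow> ('b \<Rightarrow>\<^sub>0 'c)) \<Rightarrow> ('a \<Rightarrow>\<^sub>0 'c::comm_ring_1) \<Rightarrow> ('b \<Rightarrow>\<^sub>0 'c)" where
  "linear_ext f w = (\<Sum>a\<in>Poly_Mapping.keys w. scale (Poly_Mapping.lookup w a) (f a))"

definition bilinear_ext ::
    "('a \<Rightarrow> 'a \<Rightarrow> ('b \<Rightarrow>\<^sub>0 'c)) \<Rightarrow> ('a \<Rightarrow>\<^sub>0 'c) \<Rightarrow> ('a \<Rightarrow>\<^sub>0 'c::comm_ring_1) \<Rightarrow> ('b \<Rightarrow>\<^sub>0 'c)" where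
  "bilinear_ext f v w = linear_ext (\<lambda>a. linear_ext (f a) w) v"

definition Z_star_map :: "(nat \<Rightarrow> complex) \<Rightarrow> H1 \<Rightarrow> (nat \<Rightarrow> complex set) set" where
  "Z_star_map \<zeta> w =
     (\<Oplus>\<^bsub>Acyc \<zeta>\<^esub> ks\<in>Poly_Mapping.keys w. rat_smult (Acyc \<zeta>) (Poly_Mapping.lookup w ks) (Z_star \<zeta> ks))"


section \<open>The products\<close>

fun star_word :: "nat list \<Rightarrow> nat list \<Rightarrow> H1" where
  "star_word [] w = word w"
| "star_word v [] = word v"
| "star_word (k # v) (l # w) =
     word [k] * star_word v (l # w) + word [l] * star_word (k # v) w - word [k + l] * star_word v w"

definition star :: "H1 \<Rightarrow> H1 \<Rightarrow> H1" where
  "star = bilinear_ext star_word"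

definition hbar :: "rat poly" where
  "hbar = [:0, 1:]"

fun star_q_word :: "nat list \<Rightarrow> nat list \<Rightarrow> H1hat" where
  "star_q_word [] w = word w"
| "star_q_word v [] = word v"
| "star_q_word (k # v) (l # w) =
     word [k] * star_q_word v (l # w) + word [l] * star_q_word (k # v) w
       - (word [k + l] + scale hbar (word [k + l - 1])) * star_q_word v w"

definition star_q :: "H1hat \<Rightarrow> H1hat \<Rightarrow> H1hat" where
  "star_q = bilinear_ext star_q_word"

definition L_star :: "H1 \<Rightarrow> H1" where
  "L_star = linear_ext (\<lambda>ks. scale (2 / (2 * of_nat (dep ks) - 1)) (star (word [1]) (word ks)))"

definition rho_star :: "H1hat \<Rightarrow> H1" where
  "rho_star w = (\<Sum>ks\<in>Poly_Mapping.keys w. \<Sum>i\<le>degree (Poly_Mapping.lookup w ks).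
     scale (coeff (Poly_Mapping.lookup w ks) i) ((L_star ^^ i) (word ks)))"

definition const_embed :: "H1 \<Rightarrow> H1hat" where
  "const_embed w = Poly_Mapping.map (\<lambda>c. [:c:]) w"

definition star_tilde :: "H1 \<Rightarrow> H1 \<Rightarrow> H1" where
  "star_tilde v w = rho_star (star_q (const_embed v) (const_embed w))"


section \<open>Hoffman dual and \<open>\<delta>\<close>\<close>

datatype letter = E0 | E1

text \<open>The word in $e_0, e_1$ representing $e_{\mathbf{k}}$ under $e_k = e_0^{k-1} e_1$.\<close>

definition e01_word :: "nat list \<Rightarrow> letter list" where
  "e01_word ks = concat (map (\<lambda>k. replicate (k - 1) E0 @ [E1]) ks)"

definition tau :: "letter \<Rightarrow> letter" where
  "tau x = (case x of E0 \<Rightarrow> E1 | E1 \<Rightarrow> E0)"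

definition hoffman_dual :: "nat list \<Rightarrow> nat list" where
  "hoffman_dual ks =
     (THE ls. is_index ls \<and> e01_word ls = map tau (butlast (e01_word ks)) @ [E1])"

lemma ex1_hoffman_dual:
  "\<exists>!ls. is_index ls \<and> e01_word ls = map tau (butlast (e01_word ks)) @ [E1]"
proof -
  have surj: "\<exists>ls. is_index ls \<and> e01_word ls = u @ [E1]" for u
  proof (induction u)
    case Nil
    show ?case by (rule exI[of _ "[1]"]) (simp add: is_index_def e01_word_def)
  next
    case (Cons x u)
    then obtain ls where ls: "is_index ls" "e01_word ls = u @ [E1]" by blast
    show ?case
    proof (cases x)
      case E1
      then show ?thesis
        using ls by (intro exI[of _ "1 # ls"]) (simp add: is_index_def e01_word_def)
    next
      case E0
      obtain l ls' where l: "ls = l # ls'" "l > 0"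
        using ls by (cases ls) (auto simp: is_index_def e01_word_def)
      then have "replicate l E0 = E0 # replicate (l - 1) E0"
        by (cases l) simp_all
      then show ?thesis
        using ls l E0 by (intro exI[of _ "Suc l # ls'"]) (simp add: is_index_def e01_word_def)
    qed
  qed
  have rep_inj: "a = b \<and> x = y" if "replicate a E0 @ E1 # x = replicate b E0 @ E1 # y" for a b x y
    using that
  proof (induction a arbitrary: b)
    case 0
    then show ?case by (cases b) simp_all
  next
    case (Suc a)
    then show ?case by (cases b) auto
  qed
  have inj: "ls = ms" if "is_index ls" "is_index ms" "e01_word ls = e01_word ms" for ls ms
    using that
  proof (induction ls arbitrary: ms)
    case Nil
    then show ?case by (cases ms) (simp_all add: e01_word_def)
  next
    case (Cons l ls)
    then obtain m ms' where m: "ms = m # ms'" by (cases ms) (simp_all add: e01_word_def)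
    with Cons.prems rep_inj[of "l - 1" "e01_word ls" "m - 1" "e01_word ms'"]
    have "l - 1 = m - 1" "e01_word ls = e01_word ms'" by (simp_all add: e01_word_def)
    moreover have "l > 0" "m > 0" "is_index ls" "is_index ms'"
      using Cons.prems m by (simp_all add: is_index_def)
    ultimately show ?case using Cons.IH[of ms'] m by simp
  qed
  obtain ls where "is_index ls" "e01_word ls = map tau (butlast (e01_word ks)) @ [E1]"
    using surj by blast
  then show ?thesis
    by (intro ex1I[of _ ls]) (auto intro: inj)
qed

text \<open>The map \<open>\<delta>\<close> is only meant on the span of the non-empty words; its value at the
  empty word is a dummy.\<close>

definition delta :: "H1 \<Rightarrow> H1" where
  "delta = linear_ext (\<lambda>ks. if ks = [] then 0
     else scale ((-1) ^ (wt ks + 1)) (word (rev (hoffman_dual ks))))"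

end

theory Submission
  imports Defs
begin

text \<open>The statement follows from two facts about \<open>Z\<^sup>\<star>\<close>: it is multiplicative for the product
\<^const>\<open>star_tilde\<close>, and it is invariant under \<^const>\<open>delta\<close>. Both sides of the difference are
then sent to the product of the two values, as \<^const>\<open>delta\<close> does not change them.

Invariance (\<open>z_star_duality\<close>) holds exactly, before reduction modulo \<open>p\<close>, for every primitive root
of unity. The sequence \<open>m \<mapsto> s\<^sub>m(\<^bold>k)\<close> of star sums whose largest summation variable equals \<open>m\<close>
is sent by a \<open>q\<close>-analogue of the binomial transform
\<open>f \<mapsto> (n \<mapsto> \<Sum>\<^sub>m (-1)\<^sup>m\<^sup>-\<^sup>1 (n choose m) f(m))\<close> to the truncated star sums of the Hoffman dual.
Prepending \<open>e\<^sub>0\<close> or \<open>e\<^sub>1\<close> to a word multiplies such a sequence by \<open>q\<^sup>m / [m]\<close>, respectively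
replaces it by its partial sums divided by \<open>[m]\<close>. The transform turns the former into partial
summation with weight \<open>q\<^sup>m / [m]\<close>, that is, a new entry \<open>1\<close> of the dual index, and the latter into
division of all increments by \<open>[m]\<close>, that is, a larger first entry of the dual index
(\<open>qtransform_weight\<close>, \<open>qtransform_partial_sums\<close>); this is how the Hoffman dual grows.
If \<open>q\<close> is a primitive root of unity of order \<open>n + 1\<close>, the coefficients of the transform at
\<open>n\<close> all become \<open>-1\<close>, so that the transform is minus the full star sum. The dual sums
have summands \<open>q\<^sup>m / [m]\<^sup>k\<close> instead of \<open>q\<^sup>(\<^sup>k\<^sup>-\<^sup>1\<^sup>)\<^sup>m / [m]\<^sup>k\<close>; the reflection \<open>m \<mapsto> n + 1 - m\<close>
exchanges the two shapes, reverses the index and produces the sign \<open>(-1)\<^sup>w\<^sup>t\<close>.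

Multiplicativity has two steps. Specialising \<open>\<hbar>\<close> to \<open>1 - q\<close> makes \<^const>\<open>star_q\<close> the
product formula for the sums \<^const>\<open>z_star\<close> (\<open>Z_eval_hat_star_q\<close>). The map
\<^const>\<open>rho_star\<close> replaces \<open>\<hbar>\<close> by \<^const>\<open>L_star\<close>, which modulo \<open>p\<close> has the same effect as
multiplication by \<open>1 - \<zeta>\<^sub>p\<close>: from \<open>z\<^sub>p\<^sup>\<star>(1; \<zeta>\<^sub>p) = (1 - \<zeta>\<^sub>p)(p - 1)/2\<close> and the product formula one
finds that \<open>L\<^sup>\<star>\<close> multiplies the value at \<open>\<^bold>k\<close> by \<open>(1 - \<zeta>\<^sub>p)(1 + p / (2 dep(\<^bold>k) - 1))\<close>
(\<open>Z_eval_L_star_word\<close>).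

To keep the algebra elementary, the values at all primes are treated as a family of complex numbers,
and equality in \<open>\<A>\<^sup>c\<^sup>y\<^sup>c\<close> is replaced by being negligible: some positive integer, the same
for all primes, multiplies the \<open>p\<close>-th member of the family into \<open>p \<int>[\<zeta>\<^sub>p]\<close>. Since positive integers are
units of \<open>\<A>\<^sup>c\<^sup>y\<^sup>c\<close>, negligible families vanish there (\<open>Z_star_map_eq_0\<close>).\<close>

section \<open>Truncated star sums\<close>

definition star_chains :: "nat \<Rightarrow> nat \<Rightarrow> nat list set" where
  "star_chains n r = {ms. length ms = r \<and> set ms \<subseteq> {0<..<n} \<and> sorted_wrt (\<ge>) ms}"

text \<open>The summand is left arbitrary because duality compares the sums with two different summands.\<close>

definition star_sum :: "(nat \<Rightarrow> nat \<Rightarrow> 'a) \<Rightarrow> nat \<Rightarrow> nat list \<Rightarrow> 'a::comm_semiring_1" where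
  "star_sum \<phi> n ks = (\<Sum>ms\<in>star_chains n (dep ks). \<Prod>j<dep ks. \<phi> (ks ! j) (ms ! j))"

lemma star_sum_Nil [simp]: "star_sum \<phi> n [] = 1"
proof -
  have "star_chains n 0 = {[]}" by (auto simp: star_chains_def)
  then show ?thesis by (simp add: star_sum_def)
qed

lemma star_chains_Suc:
  "star_chains n (Suc r) = (\<lambda>(m, ms). m # ms) ` (SIGMA m:{0<..<n}. star_chains (Suc m) r)"
proof (intro equalityI subsetI)
  fix xs assume "xs \<in> star_chains n (Suc r)"
  then show "xs \<in> (\<lambda>(m, ms). m # ms) ` (SIGMA m:{0<..<n}. star_chains (Suc m) r)"
    by (cases xs) (force simp: star_chains_def image_iff less_Suc_eq_le)+
next
  fix xs assume "xs \<in> (\<lambda>(m, ms). m # ms) ` (SIGMA m:{0<..<n}. star_chains (Suc m) r)"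
  then show "xs \<in> star_chains n (Suc r)"
    by (fastforce simp: star_chains_def)
qed

lemma finite_star_chains [simp]: "finite (star_chains n r)"
proof -
  have "star_chains n r \<subseteq> {ms. set ms \<subseteq> {0<..<n} \<and> length ms = r}" by (auto simp: star_chains_def)
  then show ?thesis by (rule finite_subset) (rule finite_lists_length_eq, simp)
qed

lemma star_sum_Cons:
  "star_sum \<phi> n (k # ks) = (\<Sum>m\<in>{0<..<n}. \<phi> k m * star_sum \<phi> (Suc m) ks)"
proof -
  have inj: "inj_on (\<lambda>(m, ms). m # ms) S" for S :: "(nat \<times> nat list) set"
    by (auto simp: inj_on_def)
  show ?thesis
    unfolding star_sum_def length_Cons star_chains_Suc sum.reindex[OF inj]
    by (simp add: sum.Sigma split_def prod.lessThan_Suc_shift sum_distrib_left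
        del: prod.lessThan_Suc)
qed

lemma sum_greaterThanLessThan_Suc: "(\<Sum>m\<in>{0<..<Suc n}. f m) = (\<Sum>i<n. f (Suc i))"
proof -
  have "{0<..<Suc n} = Suc ` {..<n}" by (auto simp: image_Suc_lessThan)
  then show ?thesis by (simp add: sum.reindex)
qed

lemma star_sum_Suc_Cons:
  "star_sum \<phi> (Suc n) (k # ks) = (\<Sum>i<n. \<phi> k (Suc i) * star_sum \<phi> (Suc (Suc i)) ks)"
  by (simp add: star_sum_Cons sum_greaterThanLessThan_Suc)

lemma star_sum_Suc_Suc_Cons:
  "star_sum \<phi> (Suc (Suc n)) (k # ks) =
     star_sum \<phi> (Suc n) (k # ks) + \<phi> k (Suc n) * star_sum \<phi> (Suc (Suc n)) ks"
  by (simp add: star_sum_Suc_Cons)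

lemma star_sum_cong:
  assumes "\<And>k m. k \<in> set ks \<Longrightarrow> 0 < m \<Longrightarrow> m < n \<Longrightarrow> \<phi> k m = \<psi> k m"
  shows "star_sum \<phi> n ks = star_sum \<psi> n ks"
  unfolding star_sum_def
proof (intro sum.cong prod.cong refl)
  fix ms j assume "ms \<in> star_chains n (dep ks)" "j \<in> {..<dep ks}"
  then have "ms ! j \<in> {0<..<n}" "ks ! j \<in> set ks"
    by (auto simp: star_chains_def) (metis greaterThanLessThan_iff nth_mem subsetD)+
  then show "\<phi> (ks ! j) (ms ! j) = \<psi> (ks ! j) (ms ! j)" using assms by auto
qed

text \<open>The map \<open>m \<mapsto> n - m\<close> reverses a decreasing chain, so the letters have to be read backwards.\<close>

lemma star_sum_rev: "star_sum \<phi> n (rev ks) = star_sum (\<lambda>k m. \<phi> k (n - m)) n ks"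
proof -
  define R where "R = (\<lambda>ms. rev (map (\<lambda>m. n - m) ms))"
  have R_chains: "R ms \<in> star_chains n r" if "ms \<in> star_chains n r" for ms r
  proof -
    have sorted: "sorted_wrt (\<ge>) ms" using that by (simp add: star_chains_def)
    have "sorted_wrt (\<lambda>x y. n - x \<le> n - y) ms"
      by (rule sorted_wrt_mono_rel[OF _ sorted]) auto
    then have "sorted_wrt (\<ge>) (R ms)"
      by (simp add: R_def sorted_wrt_map sorted_wrt_rev)
    then show ?thesis using that by (auto simp: R_def star_chains_def)
  qed
  have RR: "R (R ms) = ms" if "ms \<in> star_chains n r" for ms r
  proof -
    have "map (\<lambda>m. n - (n - m)) ms = map id ms"
      using that by (intro map_cong refl) (auto simp: star_chains_def)
    then show ?thesis by (simp add: R_def rev_map o_def)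
  qed
  have bij: "bij_betw R (star_chains n r) (star_chains n r)" for r
    by (rule bij_betw_byWitness[where f' = R]) (auto simp: RR R_chains)
  have prod_eq: "(\<Prod>j<dep ks. \<phi> (rev ks ! j) (R ms ! j)) = (\<Prod>j<dep ks. \<phi> (ks ! j) (n - ms ! j))"
    if ms: "ms \<in> star_chains n (dep ks)" for ms
  proof -
    have "(\<Prod>j<dep ks. \<phi> (rev ks ! j) (R ms ! j)) =
        (\<Prod>j<dep ks. \<phi> (ks ! (dep ks - Suc j)) (n - ms ! (dep ks - Suc j)))"
      using ms by (intro prod.cong refl) (simp add: R_def rev_nth star_chains_def)
    also have "\<dots> = (\<Prod>j<dep ks. \<phi> (ks ! j) (n - ms ! j))"
      by (rule prod.nat_diff_reindex)
    finally show ?thesis .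
  qed
  show ?thesis
    unfolding star_sum_def
    by (subst sum.reindex_bij_betw[OF bij, symmetric]) (simp add: prod_eq)
qed

text \<open>The square of pairs of summation indices is the union of the two closed triangles, which
overlap in the diagonal.\<close>

lemma sum_mult_sum_split:
  fixes a b :: "nat \<Rightarrow> 'a::comm_ring_1"
  shows "(\<Sum>i<n. a i) * (\<Sum>i<n. b i) =
    (\<Sum>i<n. a i * (\<Sum>j<Suc i. b j)) + (\<Sum>i<n. b i * (\<Sum>j<Suc i. a j)) - (\<Sum>i<n. a i * b i)"
  by (induction n) (simp_all add: algebra_simps)

text \<open>This is the stuffle product formula before the product of two summands has been rewritten in
terms of single summands.\<close>

lemma star_sum_mult:
  fixes \<phi> :: "nat \<Rightarrow> nat \<Rightarrow> 'a::comm_ring_1"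
  shows "star_sum \<phi> n (k # v) * star_sum \<phi> n (l # w) =
    (\<Sum>m\<in>{0<..<n}. \<phi> k m * (star_sum \<phi> (Suc m) v * star_sum \<phi> (Suc m) (l # w))) +
    (\<Sum>m\<in>{0<..<n}. \<phi> l m * (star_sum \<phi> (Suc m) (k # v) * star_sum \<phi> (Suc m) w)) -
    (\<Sum>m\<in>{0<..<n}. \<phi> k m * \<phi> l m * (star_sum \<phi> (Suc m) v * star_sum \<phi> (Suc m) w))"
proof (cases n)
  case 0
  then show ?thesis by (simp add: star_sum_Cons)
next
  case (Suc N)
  show ?thesis
    unfolding Suc sum_greaterThanLessThan_Suc star_sum_Suc_Cons sum_mult_sum_split
    by (simp add: mult_ac)
qed

definition zeta_term :: "complex \<Rightarrow> nat \<Rightarrow> nat \<Rightarrow> complex" where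
  "zeta_term q k m = q ^ ((k - 1) * m) / q_int q m ^ k"

text \<open>The reflection of the summand of \<^const>\<open>z_star\<close> at a root of unity, up to sign.\<close>

definition zeta_bar_term :: "complex \<Rightarrow> nat \<Rightarrow> nat \<Rightarrow> complex" where
  "zeta_bar_term q k m = q ^ m / q_int q m ^ k"

lemma z_star_eq_star_sum: "z_star n ks q = star_sum (zeta_term q) n ks"
  by (simp add: z_star_def star_sum_def star_chains_def zeta_term_def)

text \<open>This identity is the origin of the terms with \<open>\<hbar>\<close> in \<^const>\<open>star_q\<close>: the product carries the
power \<open>q\<^sup>(\<^sup>k\<^sup>+\<^sup>l\<^sup>-\<^sup>2\<^sup>)\<^sup>m\<close>, one factor \<open>q\<^sup>m\<close> short of the summand for \<open>k + l\<close>, and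
\<open>1 = q\<^sup>m + (1 - q) [m]\<close>.\<close>

lemma zeta_term_mult:
  assumes "k > 0" "l > 0"
  shows "zeta_term q k m * zeta_term q l m = zeta_term q (k + l) m + (1 - q) * zeta_term q (k + l - 1) m"
proof (cases "q_int q m = 0")
  case True
  then show ?thesis using assms by (simp add: zeta_term_def power_0_left)
next
  case False
  obtain a b where kl: "k = Suc a" "l = Suc b" using assms by (metis gr0_implies_Suc)
  have q: "(1 - q) * q_int q m = 1 - q ^ m"
    using False by (auto simp: q_int_def)
  have e: "zeta_term q (k + l) m = q ^ m * q ^ ((a + b) * m) / q_int q m ^ (a + b + 2)"
     "zeta_term q (k + l - 1) m = q ^ ((a + b) * m) * q_int q m / q_int q m ^ (a + b + 2)"
     "zeta_term q k m * zeta_term q l m = q ^ ((a + b) * m) / q_int q m ^ (a + b + 2)"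
    using False
    by (simp_all add: zeta_term_def kl power_add[symmetric] algebra_simps divide_simps)
  have "(1 - q) * zeta_term q (k + l - 1) m = q ^ ((a + b) * m) * ((1 - q) * q_int q m) / q_int q m ^ (a + b + 2)"
    by (simp only: e) (simp add: mult_ac)
  then have "(1 - q) * zeta_term q (k + l - 1) m = q ^ ((a + b) * m) * (1 - q ^ m) / q_int q m ^ (a + b + 2)"
    by (simp only: q)
  then show ?thesis unfolding e by (simp only: e) (simp add: field_simps add_divide_distrib[symmetric])
qed

section \<open>A q-analogue of the binomial transform\<close>

fun qbinom :: "'a::comm_ring_1 \<Rightarrow> nat \<Rightarrow> nat \<Rightarrow> 'a" where
  "qbinom q n 0 = 1"
| "qbinom q 0 (Suc k) = 0"
| "qbinom q (Suc n) (Suc k) = q ^ Suc k * qbinom q n (Suc k) + qbinom q n k"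

lemma qbinom_eq_0: "n < k \<Longrightarrow> qbinom q n k = 0"
  by (induction q n k rule: qbinom.induct) auto

text \<open>The quotient of neighbouring \<open>q\<close>-binomials, multiplied by a power of \<open>q\<close> so as to avoid
subtraction in exponents. The absorption identity and the second Pascal rule are both
rearrangements of it.\<close>

lemma qbinom_Suc_right:
  "(1 - q ^ Suc k) * q ^ Suc k * qbinom q n (Suc k) = (q ^ Suc k - q ^ Suc n) * qbinom q n k"
proof (induction n arbitrary: k)
  case 0
  show ?case by (cases k) simp_all
next
  case (Suc n)
  have absorb: "(1 - q ^ Suc k) * qbinom q (Suc n) (Suc k) = (1 - q ^ Suc n) * qbinom q n k" for k
    using Suc[of k] by (simp add: algebra_simps)
  show ?case
  proof (cases k)
    case 0
    then show ?thesis
      using arg_cong[OF absorb[of 0], of "(*) q"] by (simp add: algebra_simps del: qbinom.simps(3))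
  next
    case (Suc m)
    have "(q ^ Suc k - q ^ Suc (Suc n)) * qbinom q (Suc n) k =
        (q ^ Suc k - q ^ Suc (Suc n)) * q ^ k * qbinom q n k +
        q * ((q ^ Suc m - q ^ Suc n) * qbinom q n m)"
      by (simp add: Suc algebra_simps)
    also have "\<dots> = (q ^ Suc k - q ^ Suc (Suc n)) * q ^ k * qbinom q n k +
        q * ((1 - q ^ k) * q ^ k * qbinom q n k)"
      using Suc.IH[of m] Suc by (simp only:)
    also have "\<dots> = q ^ Suc k * ((1 - q ^ Suc n) * qbinom q n k)"
      by (simp add: algebra_simps)
    also have "\<dots> = (1 - q ^ Suc k) * q ^ Suc k * qbinom q (Suc n) (Suc k)"
      by (simp only: absorb[symmetric]) (simp only: mult_ac)
    finally show ?thesis ..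
  qed
qed

lemma qbinom_absorb:
  "(1 - q ^ Suc k) * qbinom q (Suc n) (Suc k) = (1 - q ^ Suc n) * qbinom q n k"
  using qbinom_Suc_right[of q k n] by (simp add: algebra_simps)

lemma qbinom_Suc_diff:
  "q ^ Suc k * (qbinom q (Suc n) (Suc k) - qbinom q n (Suc k)) = q ^ Suc n * qbinom q n k"
  using qbinom_Suc_right[of q k n] by (simp add: algebra_simps)

text \<open>At a root of unity of order \<open>n + 1\<close> the quotient of neighbouring \<open>q\<close>-binomials is minus a power
of \<open>q\<close>.\<close>

lemma qbinom_root_of_unity:
  fixes q :: "'a::field"
  assumes "q ^ Suc n = 1" and "\<And>m. 0 < m \<Longrightarrow> m \<le> n \<Longrightarrow> q ^ m \<noteq> 1" and "k \<le> n"
  shows "q ^ (\<Sum>{..k}) * qbinom q n k = (-1) ^ k"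
  using assms(3)
proof (induction k)
  case 0
  show ?case by simp
next
  case (Suc k)
  have "1 - q ^ Suc k \<noteq> 0" using assms(2)[of "Suc k"] Suc.prems by auto
  moreover have "(1 - q ^ Suc k) * (q ^ Suc k * qbinom q n (Suc k)) = (1 - q ^ Suc k) * (- qbinom q n k)"
    using qbinom_Suc_right[of q k n] unfolding assms(1)
    by (simp add: algebra_simps del: power_Suc)
  ultimately have "q ^ Suc k * qbinom q n (Suc k) = - qbinom q n k" by (metis mult_left_cancel)
  moreover have "q ^ (\<Sum>{..Suc k}) * qbinom q n (Suc k) = q ^ (\<Sum>{..k}) * (q ^ Suc k * qbinom q n (Suc k))"
    by (simp add: power_add mult_ac)
  ultimately have "q ^ (\<Sum>{..Suc k}) * qbinom q n (Suc k) = - (q ^ (\<Sum>{..k}) * qbinom q n k)"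
    by (simp only: mult_minus_right)
  with Suc show ?case by simp
qed

text \<open>The summation variable is \<open>m = i + 1\<close>; the power of \<open>q\<close> is \<open>q\<^sup>m\<^sup>(\<^sup>m\<^sup>+\<^sup>1\<^sup>)\<^sup>/\<^sup>2\<close>.\<close>

definition qtransform :: "'a::comm_ring_1 \<Rightarrow> (nat \<Rightarrow> 'a) \<Rightarrow> nat \<Rightarrow> 'a" where
  "qtransform q f n = (\<Sum>i<n. (-1) ^ i * q ^ (\<Sum>{..Suc i}) * qbinom q n (Suc i) * f (Suc i))"

text \<open>Differences in \<open>n\<close> are what the duality argument compares, as the dual sums are partial sums.
The second Pascal rule turns the difference of the coefficients into a single \<open>q\<close>-binomial.\<close>

lemma qtransform_Suc:
  "qtransform q f (Suc n) - qtransform q f n =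
     q ^ Suc n * (\<Sum>i<Suc n. (-1) ^ i * q ^ (\<Sum>{..i}) * qbinom q n i * f (Suc i))"
proof -
  have "qtransform q f n = (\<Sum>i<Suc n. (-1) ^ i * q ^ (\<Sum>{..Suc i}) * qbinom q n (Suc i) * f (Suc i))"
    by (simp add: qtransform_def qbinom_eq_0)
  then have "qtransform q f (Suc n) - qtransform q f n =
      (\<Sum>i<Suc n. (-1) ^ i * q ^ (\<Sum>{..i}) * f (Suc i) *
         (q ^ Suc i * (qbinom q (Suc n) (Suc i) - qbinom q n (Suc i))))"
    unfolding qtransform_def
    by (simp only: sum_subtractf[symmetric]) (simp add: power_add algebra_simps)
  then show ?thesis
    unfolding qbinom_Suc_diff by (simp add: sum_distrib_left mult_ac del: sum.lessThan_Suc)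
qed

lemma q_int_qbinom_absorb:
  "q_int q (Suc k) * qbinom q (Suc n) (Suc k) = q_int q (Suc n) * qbinom q n k"
  using qbinom_absorb[of q k n] by (simp add: q_int_def)

lemma qbinom_div_q_int:
  assumes "\<And>m. 0 < m \<Longrightarrow> m \<le> Suc n \<Longrightarrow> q_int q m \<noteq> 0" and "i \<le> n"
  shows "qbinom q n i / q_int q (Suc i) = qbinom q (Suc n) (Suc i) / q_int q (Suc n)"
  using q_int_qbinom_absorb[of q i n] assms(1)[of "Suc n"] assms(1)[of "Suc i"] assms(2)
  by (simp add: field_simps)

text \<open>Multiplying by \<open>q\<^sup>m / [m]\<close>, the effect of a letter \<open>e\<^sub>0\<close>, becomes partial summation with weight
\<open>q\<^sup>n / [n]\<close>, the effect of a letter \<open>e\<^sub>1\<close> on the dual side: absorption moves the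
denominator out of the sum.\<close>

lemma qtransform_weight:
  assumes nz: "\<And>m. 0 < m \<Longrightarrow> m \<le> Suc n \<Longrightarrow> q_int q m \<noteq> 0"
  shows "qtransform q (\<lambda>m. q ^ m / q_int q m * f m) (Suc n) - qtransform q (\<lambda>m. q ^ m / q_int q m * f m) n =
    q ^ Suc n / q_int q (Suc n) * qtransform q f (Suc n)"
proof -
  have "(\<Sum>i<Suc n. (-1) ^ i * q ^ (\<Sum>{..i}) * qbinom q n i * (q ^ Suc i / q_int q (Suc i) * f (Suc i))) =
    (\<Sum>i<Suc n. (-1) ^ i * q ^ (\<Sum>{..Suc i}) * (qbinom q n i / q_int q (Suc i)) * f (Suc i))"
    by (intro sum.cong refl) (simp add: power_add mult_ac)
  also have "\<dots> = (\<Sum>i<Suc n. (-1) ^ i * q ^ (\<Sum>{..Suc i}) * (qbinom q (Suc n) (Suc i) / q_int q (Suc n)) * f (Suc i))"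
    using qbinom_div_q_int[OF nz] by (intro sum.cong refl) simp
  also have "\<dots> = qtransform q f (Suc n) / q_int q (Suc n)"
    unfolding qtransform_def by (simp add: sum_divide_distrib del: sum.lessThan_Suc)
  finally show ?thesis unfolding qtransform_Suc by (simp only: times_divide_eq_left times_divide_eq_right)
qed

lemma sum_by_parts:
  fixes a F :: "nat \<Rightarrow> 'a::comm_ring_1"
  shows "(\<Sum>i<n. (a i - a (Suc i)) * F (Suc i)) =
    a 0 * F 0 - a n * F n + (\<Sum>i<n. a i * (F (Suc i) - F i))"
  by (induction n) (simp_all add: algebra_simps)

text \<open>Conversely, passing to partial sums \<open>F\<close> and dividing by \<open>[m]\<close> becomes division of the
increments by \<open>[n]\<close>, because by the first Pascal rule the coefficients of \<open>F\<close> are themselves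
increments, and one can sum by parts. A non-zero starting value \<open>F 0\<close> is admitted for the sake of
the one-letter word.\<close>

lemma qtransform_partial_sums:
  assumes nz: "\<And>m. 0 < m \<Longrightarrow> m \<le> Suc n \<Longrightarrow> q_int q m \<noteq> 0"
  shows "qtransform q (\<lambda>m. F m / q_int q m) (Suc n) - qtransform q (\<lambda>m. F m / q_int q m) n =
    (q ^ Suc n * F 0 + (qtransform q (\<lambda>m. F m - F (m - 1)) (Suc n) - qtransform q (\<lambda>m. F m - F (m - 1)) n))
       / q_int q (Suc n)"
proof -
  \<comment> \<open>These are the coefficients of the increments of \<open>F\<close> in \<open>qtransform_Suc\<close>.\<close>
  define a where "a = (\<lambda>i. (-1) ^ i * q ^ (\<Sum>{..i}) * qbinom q n i)"
  have "(\<Sum>i<Suc n. (-1) ^ i * q ^ (\<Sum>{..i}) * qbinom q n i * (F (Suc i) / q_int q (Suc i))) =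
    (\<Sum>i<Suc n. (-1) ^ i * q ^ (\<Sum>{..i}) * (qbinom q n i / q_int q (Suc i)) * F (Suc i))"
    by (intro sum.cong refl) simp
  also have "\<dots> = (\<Sum>i<Suc n. (-1) ^ i * q ^ (\<Sum>{..i}) * (qbinom q (Suc n) (Suc i) / q_int q (Suc n)) * F (Suc i))"
    using qbinom_div_q_int[OF nz] by (intro sum.cong refl) simp
  also have "\<dots> = (\<Sum>i<Suc n. (a i - a (Suc i)) * F (Suc i)) / q_int q (Suc n)"
    unfolding sum_divide_distrib
    by (intro sum.cong refl) (simp add: a_def power_add algebra_simps)
  also have "(\<Sum>i<Suc n. (a i - a (Suc i)) * F (Suc i)) = F 0 + (\<Sum>i<Suc n. a i * (F (Suc i) - F i))"
    unfolding sum_by_parts by (simp add: a_def qbinom_eq_0)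
  finally show ?thesis
    unfolding qtransform_Suc a_def by (simp add: algebra_simps del: sum.lessThan_Suc)
qed

section \<open>Hoffman duality at roots of unity\<close>

lemma e01_word_Nil [simp]: "e01_word [] = []"
  and e01_word_Cons [simp]: "e01_word (k # ks) = replicate (k - 1) E0 @ E1 # e01_word ks"
  by (simp_all add: e01_word_def)

lemma e01_word_eq_Nil_iff [simp]: "e01_word ks = [] \<longleftrightarrow> ks = []"
  by (cases ks) simp_all

lemma length_e01_word: "is_index ks \<Longrightarrow> length (e01_word ks) = wt ks"
  by (induction ks) (auto simp: is_index_def)

lemma hoffman_dual_props:
  "is_index (hoffman_dual ks)" "e01_word (hoffman_dual ks) = map tau (butlast (e01_word ks)) @ [E1]"
  using theI'[OF ex1_hoffman_dual[of ks]] by (simp_all add: hoffman_dual_def)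

lemma hoffman_dual_eqI:
  assumes "is_index ls" "e01_word ls = map tau (butlast (e01_word ks)) @ [E1]"
  shows "hoffman_dual ks = ls"
  using the1_equality[OF ex1_hoffman_dual, of ls ks] assms by (simp add: hoffman_dual_def)

lemma hoffman_dual_nonempty: "hoffman_dual ks \<noteq> []"
  using hoffman_dual_props(2)[of ks] by (cases "hoffman_dual ks") simp_all

lemma wt_hoffman_dual:
  assumes "is_index ks" "ks \<noteq> []"
  shows "wt (hoffman_dual ks) = wt ks"
proof -
  have "wt (hoffman_dual ks) = length (e01_word (hoffman_dual ks))"
    by (simp add: length_e01_word hoffman_dual_props(1))
  also have "\<dots> = length (e01_word ks)"
    using assms by (simp add: hoffman_dual_props(2))
  finally show ?thesis using assms by (simp add: length_e01_word)
qed

lemma hoffman_dual_1: "hoffman_dual [1] = [1]"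
  by (rule hoffman_dual_eqI) (simp_all add: is_index_def)

lemma hoffman_dual_Suc_Cons:
  "hoffman_dual (Suc (Suc j) # ks) = 1 # hoffman_dual (Suc j # ks)"
  by (rule hoffman_dual_eqI)
    (use hoffman_dual_props[of "Suc j # ks"] in \<open>auto simp: is_index_def tau_def butlast_append\<close>)

lemma hoffman_dual_1_Cons:
  assumes "ks \<noteq> []" "hoffman_dual ks = l # ls"
  shows "hoffman_dual (1 # ks) = Suc l # ls"
proof (rule hoffman_dual_eqI)
  have l: "is_index (l # ls)" "e01_word (l # ls) = map tau (butlast (e01_word ks)) @ [E1]"
    using hoffman_dual_props[of ks] assms(2) by auto
  then show "is_index (Suc l # ls)" by (simp add: is_index_def)
  obtain i where "l = Suc i" using l(1) by (cases l) (auto simp: is_index_def)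
  then show "e01_word (Suc l # ls) = map tau (butlast (e01_word (1 # ks))) @ [E1]"
    using l(2) assms(1) by (simp add: tau_def)
qed

text \<open>This induction adds one letter \<open>e\<^sub>1\<close> or \<open>e\<^sub>0\<close> at a time to the front of the word in \<open>e\<^sub>0, e\<^sub>1\<close>, which is
how the Hoffman dual is built.\<close>

lemma index_induct [consumes 2, case_names one one_Cons Suc]:
  assumes "is_index ks" "ks \<noteq> []"
    and "P [1]"
    and "\<And>ks. is_index ks \<Longrightarrow> ks \<noteq> [] \<Longrightarrow> P ks \<Longrightarrow> P (1 # ks)"
    and "\<And>j ks. is_index ks \<Longrightarrow> P (Suc j # ks) \<Longrightarrow> P (Suc (Suc j) # ks)"
  shows "P ks"
  using assms(1,2)
proof (induction ks)
  case (Cons k ks)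
  have ks: "is_index ks" using Cons.prems by (simp add: is_index_def)
  have "P (Suc j # ks)" for j
  proof (induction j)
    case 0
    show ?case using assms(3) assms(4)[OF ks] Cons.IH[OF ks] by (cases "ks = []") auto
  next
    case (Suc j)
    then show ?case using assms(5)[OF ks] by simp
  qed
  moreover obtain j where "k = Suc j" using Cons.prems by (cases k) (auto simp: is_index_def)
  ultimately show ?case by simp
qed simp

text \<open>The part of the star sum in which the largest summation variable equals \<open>m\<close>.\<close>

definition outer_term :: "complex \<Rightarrow> nat list \<Rightarrow> nat \<Rightarrow> complex" where
  "outer_term q ks m = zeta_term q (hd ks) m * star_sum (zeta_term q) (Suc m) (tl ks)"

lemma zeta_bar_term_Suc: "zeta_bar_term q (Suc k) m = zeta_bar_term q k m / q_int q m"
  by (simp add: zeta_bar_term_def)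

lemma zeta_bar_term_Suc_0: "zeta_bar_term q (Suc 0) m = q ^ m / q_int q m"
  by (simp add: zeta_bar_term_def)

lemma qtransform_0 [simp]: "qtransform q f 0 = 0"
  by (simp add: qtransform_def)

lemma star_sum_Suc_0_Cons [simp]: "star_sum \<phi> (Suc 0) (k # ks) = 0"
  by (simp add: star_sum_Suc_Cons)

text \<open>The two rules for the transform match the way in which a letter added to an index changes its
dual. Non-vanishing of \<open>[m]\<close> is required only up to \<open>N\<close>, so that \<open>q\<close> may be a root of unity
of order \<open>N + 1\<close>.\<close>

lemma qtransform_outer_term:
  assumes "is_index ks" "ks \<noteq> []" and nz: "\<And>m. 0 < m \<Longrightarrow> m \<le> N \<Longrightarrow> q_int q m \<noteq> 0" and "n \<le> N"
  shows "qtransform q (outer_term q ks) n = star_sum (zeta_bar_term q) (Suc n) (hoffman_dual ks)"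
  using assms(1,2,4)
proof (induction ks arbitrary: n rule: index_induct)
  case one
  have f: "outer_term q [1] = (\<lambda>m. 1 / q_int q m)"
    by (simp add: outer_term_def zeta_term_def fun_eq_iff)
  show ?case
    using \<open>n \<le> N\<close>
  proof (induction n)
    case 0
    show ?case by (simp add: hoffman_dual_1[simplified])
  next
    case (Suc n)
    have "qtransform q (outer_term q [1]) (Suc n) - qtransform q (outer_term q [1]) n = q ^ Suc n / q_int q (Suc n)"
      unfolding f using qtransform_partial_sums[of n q "\<lambda>_. 1"] nz Suc.prems
      by (simp add: qtransform_def)
    then show ?case
      using Suc by (simp add: hoffman_dual_1[simplified] star_sum_Suc_Suc_Cons zeta_bar_term_def diff_eq_eq)
  qed
next
  case (one_Cons ks)
  obtain l ls where dual: "hoffman_dual ks = l # ls"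
    using hoffman_dual_nonempty[of ks] by (cases "hoffman_dual ks") auto
  obtain k v where ks: "ks = k # v" using one_Cons by (cases ks) auto
  define F where "F = (\<lambda>m. star_sum (zeta_term q) (Suc m) ks)"
  have f: "outer_term q (1 # ks) = (\<lambda>m. F m / q_int q m)"
    by (simp add: outer_term_def zeta_term_def fun_eq_iff F_def)
  have F0: "F 0 = 0" by (simp add: F_def ks)
  have dF: "qtransform q (\<lambda>m. F m - F (m - 1)) n = qtransform q (outer_term q ks) n" for n
    unfolding qtransform_def F_def ks outer_term_def
    by (intro sum.cong refl) (simp add: star_sum_Suc_Suc_Cons)
  show ?case
    using \<open>n \<le> N\<close>
  proof (induction n)
    case 0
    show ?case by (simp add: hoffman_dual_1_Cons[OF \<open>ks \<noteq> []\<close> dual, simplified])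
  next
    case (Suc n)
    have "qtransform q (outer_term q (1 # ks)) (Suc n) - qtransform q (outer_term q (1 # ks)) n =
        (qtransform q (outer_term q ks) (Suc n) - qtransform q (outer_term q ks) n) / q_int q (Suc n)"
      unfolding f using qtransform_partial_sums[of n q F] nz Suc.prems F0 dF by simp
    also have "\<dots> = zeta_bar_term q (Suc l) (Suc n) * star_sum (zeta_bar_term q) (Suc (Suc n)) ls"
      using one_Cons.IH[of n] one_Cons.IH[of "Suc n"] Suc.prems
      by (simp add: dual star_sum_Suc_Suc_Cons zeta_bar_term_Suc)
    finally show ?case
      using Suc by (simp add: hoffman_dual_1_Cons[OF \<open>ks \<noteq> []\<close> dual, simplified] star_sum_Suc_Suc_Cons diff_eq_eq)
  qed
next
  case (Suc j ks)
  have f: "outer_term q (Suc (Suc j) # ks) = (\<lambda>m. q ^ m / q_int q m * outer_term q (Suc j # ks) m)"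
    by (simp add: outer_term_def zeta_term_def fun_eq_iff power_add)
  note IH = Suc.IH
  show ?case
    using \<open>n \<le> N\<close>
  proof (induction n)
    case 0
    show ?case by (simp add: hoffman_dual_Suc_Cons)
  next
    case (Suc n)
    have "qtransform q (outer_term q (Suc (Suc j) # ks)) (Suc n) - qtransform q (outer_term q (Suc (Suc j) # ks)) n =
        zeta_bar_term q 1 (Suc n) * star_sum (zeta_bar_term q) (Suc (Suc n)) (hoffman_dual (Suc j # ks))"
      unfolding f using qtransform_weight[of n q "outer_term q (Suc j # ks)"] nz Suc.prems IH[of "Suc n"]
      by (simp add: zeta_bar_term_Suc_0)
    then show ?case
      using Suc by (simp add: hoffman_dual_Suc_Cons star_sum_Suc_Suc_Cons diff_eq_eq)
  qed
qed

lemma primitive_root_of_unity_q_int_nonzero: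
  assumes "primitive_root_of_unity n z" "0 < m" "m < n"
  shows "q_int z m \<noteq> 0"
proof -
  have "z ^ m \<noteq> 1" "z \<noteq> 1" using assms by (auto simp: primitive_root_of_unity_def)
  then show ?thesis by (simp add: q_int_def)
qed

lemma star_sum_scale_weight:
  "star_sum (\<lambda>k m. c ^ k * \<phi> k m) n ks = c ^ wt ks * star_sum \<phi> n ks"
proof (induction ks arbitrary: n)
  case (Cons k ks)
  then show ?case by (simp add: star_sum_Cons sum_distrib_left power_add mult_ac)
qed simp

text \<open>Since \<open>[n - m] = - [m] / z\<^sup>m\<close>, the reflection \<open>m \<mapsto> n - m\<close> turns one kind of summand into
the other, with one sign for each unit of weight.\<close>

lemma star_sum_zeta_term_rev:
  assumes z: "primitive_root_of_unity n z" and "is_index ks"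
  shows "star_sum (zeta_term z) n (rev ks) = (-1) ^ wt ks * star_sum (zeta_bar_term z) n ks"
proof -
  have zn: "z ^ n = 1" and z0: "z \<noteq> 0"
    using z by (auto simp: primitive_root_of_unity_def power_0_left split: if_splits)
  have "star_sum (zeta_term z) n (rev ks) = star_sum (\<lambda>k m. zeta_term z k (n - m)) n ks"
    by (rule star_sum_rev)
  also have "\<dots> = star_sum (\<lambda>k m. (-1) ^ k * zeta_bar_term z k m) n ks"
  proof (rule star_sum_cong)
    fix k m assume k: "k \<in> set ks" and m: "0 < m" "m < n"
    obtain j where j: "k = Suc j"
      using k assms(2) gr0_implies_Suc by (auto simp: is_index_def)
    have qm: "q_int z m \<noteq> 0" by (rule primitive_root_of_unity_q_int_nonzero[OF z m])
    have znm: "z ^ (n - m) * z ^ m = 1" using m zn by (simp add: power_add[symmetric])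
    then have inv: "z ^ (n - m) = 1 / z ^ m" using z0 by (simp add: field_simps)
    have qnm: "q_int z (n - m) = - q_int z m / z ^ m"
      using z0 by (cases "z = 1") (simp_all add: q_int_def inv field_simps)
    have sign: "(-1) ^ k * ((-1) ^ k * x) = x" for x :: complex
      by (simp add: mult.assoc[symmetric] power_mult_distrib[symmetric])
    have "zeta_term z k (n - m) = (1 / z ^ m) ^ j / (- q_int z m / z ^ m) ^ Suc j"
      by (simp add: zeta_term_def j qnm inv[symmetric] power_mult[symmetric] mult.commute)
    also have "\<dots> = z ^ m / (- q_int z m) ^ k"
      using z0 qm by (simp only: power_divide j) (simp add: divide_simps)
    also have "\<dots> = (-1) ^ k * zeta_bar_term z k m"
      using qm by (simp add: zeta_bar_term_def power_minus[of "q_int z m"] sign field_simps)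
    finally show "zeta_term z k (n - m) = (-1) ^ k * zeta_bar_term z k m" .
  qed
  finally show ?thesis by (simp add: star_sum_scale_weight)
qed

text \<open>The transform at \<open>n - 1\<close> is minus the star sum, and it also is the reflected star sum of the
dual index.\<close>

lemma z_star_duality:
  assumes z: "primitive_root_of_unity n z" and ks: "is_index ks" "ks \<noteq> []"
  shows "z_star n ks z = (-1) ^ (wt ks + 1) * z_star n (rev (hoffman_dual ks)) z"
proof -
  obtain N where n: "n = Suc N" using z by (cases n) (auto simp: primitive_root_of_unity_def)
  obtain k v where kv: "ks = k # v" using ks by (cases ks) auto
  have zN: "z ^ Suc N = 1" and ne: "\<And>m. 0 < m \<Longrightarrow> m \<le> N \<Longrightarrow> z ^ m \<noteq> 1"
    using z by (auto simp: primitive_root_of_unity_def n)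
  have "qtransform z (outer_term z ks) N = - (\<Sum>i<N. outer_term z ks (Suc i))"
    unfolding qtransform_def sum_negf[symmetric]
  proof (intro sum.cong refl)
    fix i assume "i \<in> {..<N}"
    then have "z ^ (\<Sum>{..Suc i}) * qbinom z N (Suc i) = (-1) ^ Suc i"
      using qbinom_root_of_unity[OF zN ne, of "Suc i"] by simp
    then show "(-1) ^ i * z ^ (\<Sum>{..Suc i}) * qbinom z N (Suc i) * outer_term z ks (Suc i) = - outer_term z ks (Suc i)"
      by (simp only: mult.assoc[of "(-1) ^ i"]) (simp add: power_add[symmetric])
  qed
  also have "(\<Sum>i<N. outer_term z ks (Suc i)) = z_star n ks z"
    by (simp add: z_star_eq_star_sum n kv star_sum_Suc_Cons outer_term_def)
  finally have "z_star n ks z = - star_sum (zeta_bar_term z) n (hoffman_dual ks)"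
    using qtransform_outer_term[OF ks, of N z N] primitive_root_of_unity_q_int_nonzero[OF z]
    by (simp add: n)
  moreover have "z_star n (rev (hoffman_dual ks)) z = (-1) ^ wt ks * star_sum (zeta_bar_term z) n (hoffman_dual ks)"
    using star_sum_zeta_term_rev[OF z hoffman_dual_props(1)[of ks]] ks
    by (simp add: z_star_eq_star_sum wt_hoffman_dual)
  ultimately show ?thesis by (simp add: power_add[symmetric])
qed

section \<open>Linear functionals on the free algebra\<close>

lemma lookup_scale: "Poly_Mapping.lookup (scale c w) a = c * Poly_Mapping.lookup w a"
  unfolding scale_def by (simp add: Poly_Mapping.map.rep_eq when_def)

lemma scale_eq_single_mult: "scale c w = Poly_Mapping.single 0 c * (w :: 'a::monoid_add \<Rightarrow>\<^sub>0 'c::comm_ring_1)"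
  by (simp add: scale_def mult_map_scale_conv_mult)

lemma scale_mult_left: "scale c v * w = scale c (v * (w :: 'a::monoid_add \<Rightarrow>\<^sub>0 'c::comm_ring_1))"
  by (simp add: scale_eq_single_mult mult.assoc)

lemma scale_1 [simp]: "scale 1 w = w"
  by (rule poly_mapping_eqI) (simp add: lookup_scale)

lemma keys_scale: "Poly_Mapping.keys (scale c w) \<subseteq> Poly_Mapping.keys w"
  by (auto simp: in_keys_iff lookup_scale)

lemma keys_minus_subset:
  "Poly_Mapping.keys (v - w) \<subseteq> Poly_Mapping.keys v \<union> Poly_Mapping.keys (w :: 'a \<Rightarrow>\<^sub>0 'c::ab_group_add)"
  by (auto simp: in_keys_iff lookup_minus)

lemma keys_sum_subset:
  "Poly_Mapping.keys (\<Sum>i\<in>I. w i) \<subseteq> (\<Union>i\<in>I. Poly_Mapping.keys (w i :: 'a \<Rightarrow>\<^sub>0 'c::comm_monoid_add))"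
proof (induction I rule: infinite_finite_induct)
  case (insert i I)
  then show ?case using keys_add[of "w i" "\<Sum>i\<in>I. w i"] by auto
qed auto

lemma keys_linear_ext:
  "Poly_Mapping.keys (linear_ext f w) \<subseteq> (\<Union>a\<in>Poly_Mapping.keys w. Poly_Mapping.keys (f a))"
  unfolding linear_ext_def using keys_sum_subset keys_scale by fastforce

lemma keys_word [simp]: "Poly_Mapping.keys (word ks) = {ks}"
  by (simp add: word_def)

lemma lookup_word: "Poly_Mapping.lookup (word ks) ls = (1 when ks = ls)"
  by (simp add: word_def lookup_single)

lemma linear_ext_word [simp]: "linear_ext f (word ks) = f ks"
  by (simp add: linear_ext_def lookup_word)

lemma keys_letter_mult:
  "Poly_Mapping.keys (word [k] * w :: nat list \<Rightarrow>\<^sub>0 'c::comm_ring_1) \<subseteq> (#) k ` Poly_Mapping.keys w"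
  using keys_mult[of "word [k]" w] by (auto simp: plus_list_def)

lemma sum_single_lookup: "(\<Sum>a\<in>Poly_Mapping.keys w. Poly_Mapping.single a (Poly_Mapping.lookup w a)) = w"
  by (rule poly_mapping_eqI) (auto simp: lookup_sum lookup_single when_def in_keys_iff)

text \<open>Values of words in a commutative ring extend to linear combinations of words along a ring
homomorphism of coefficients. Rational coefficients and coefficients in \<open>\<rat>[\<hbar>]\<close> both
occur below.\<close>

locale coeff_hom =
  fixes h :: "'c::comm_ring_1 \<Rightarrow> 'd::comm_ring_1"
  assumes hom_add: "h (a + b) = h a + h b"
    and hom_mult: "h (a * b) = h a * h b"
    and hom_1 [simp]: "h 1 = 1"
begin

definition eval :: "('a \<Rightarrow> 'd) \<Rightarrow> ('a \<Rightarrow>\<^sub>0 'c) \<Rightarrow> 'd" where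
  "eval F w = (\<Sum>a\<in>Poly_Mapping.keys w. h (Poly_Mapping.lookup w a) * F a)"

lemma hom_0 [simp]: "h 0 = 0"
  using hom_add[of 0 0] by simp

lemma eval_superset:
  assumes "finite A" "Poly_Mapping.keys w \<subseteq> A"
  shows "eval F w = (\<Sum>a\<in>A. h (Poly_Mapping.lookup w a) * F a)"
  unfolding eval_def using assms by (intro sum.mono_neutral_left) (auto simp: in_keys_iff)

lemma eval_cong:
  "(\<And>a. a \<in> Poly_Mapping.keys w \<Longrightarrow> F a = G a) \<Longrightarrow> eval F w = eval G w"
  by (simp add: eval_def)

lemma eval_0 [simp]: "eval F 0 = 0"
  by (simp add: eval_def)

lemma eval_add: "eval F (v + w) = eval F v + eval F w"
proof -
  let ?A = "Poly_Mapping.keys v \<union> Poly_Mapping.keys w"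
  have "eval F v = (\<Sum>a\<in>?A. h (Poly_Mapping.lookup v a) * F a)"
    "eval F w = (\<Sum>a\<in>?A. h (Poly_Mapping.lookup w a) * F a)"
    "eval F (v + w) = (\<Sum>a\<in>?A. h (Poly_Mapping.lookup (v + w) a) * F a)"
    using keys_add[of v w] by (intro eval_superset; auto)+
  then show ?thesis
    by (simp add: lookup_add hom_add distrib_right sum.distrib)
qed

lemma eval_minus: "eval F (v - w) = eval F v - eval F w"
  using eval_add[of F "v - w" w] by simp

lemma eval_sum: "eval F (\<Sum>i\<in>I. w i) = (\<Sum>i\<in>I. eval F (w i))"
  by (induction I rule: infinite_finite_induct) (simp_all add: eval_add)

lemma eval_scale: "eval F (scale c w) = h c * eval F w"
  by (subst eval_superset[OF _ keys_scale])
    (simp_all add: lookup_scale hom_mult eval_def sum_distrib_left mult.assoc)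

lemma eval_single: "eval F (Poly_Mapping.single a c) = h c * F a"
  by (simp add: eval_def)

lemma eval_word [simp]: "eval F (word ks) = F ks"
  by (simp add: word_def eval_single)

lemma eval_linear_ext: "eval F (linear_ext f w) = eval (\<lambda>a. eval F (f a)) w"
  unfolding linear_ext_def eval_sum eval_scale by (simp add: eval_def)

lemma eval_bilinear_ext:
  "eval F (bilinear_ext f v w) = eval (\<lambda>a. eval (\<lambda>b. eval F (f a b)) w) v"
  by (simp add: bilinear_ext_def eval_linear_ext)

lemma eval_mult_right: "eval (\<lambda>a. F a * c) w = eval F w * c"
  by (simp add: eval_def sum_distrib_right mult.assoc)

lemma eval_mult_left: "eval (\<lambda>a. c * F a) w = c * eval F w"
  by (simp add: eval_def sum_distrib_left mult_ac)

lemma eval_letter_mult: "eval F (word [k] * w) = eval (\<lambda>ks. F (k # ks)) w"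
proof -
  have "word [k] * Poly_Mapping.single a c = Poly_Mapping.single (k # a) (c :: 'c)" for a c
    by (simp add: word_def mult_single plus_list_def)
  then have "eval F (word [k] * (\<Sum>a\<in>Poly_Mapping.keys w. Poly_Mapping.single a (Poly_Mapping.lookup w a)))
     = eval (\<lambda>ks. F (k # ks)) w"
    by (simp add: sum_distrib_left eval_sum eval_single) (simp add: eval_def)
  then show ?thesis by (simp only: sum_single_lookup)
qed

lemma eval_star_sum_letter_mult:
  "eval (star_sum \<phi> n) (word [k] * w) = (\<Sum>m\<in>{0<..<n}. \<phi> k m * eval (star_sum \<phi> (Suc m)) w)"
  unfolding eval_letter_mult star_sum_Cons
  by (simp add: eval_def sum_distrib_left sum.swap[of _ "{0<..<n}"] mult_ac)

end

section \<open>The values of the products\<close>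

text \<open>The recursion defining \<^const>\<open>star_q_word\<close> mirrors
the stuffle product formula term by term, once \<open>\<hbar>\<close> is specialised to \<open>1 - q\<close>.\<close>

lemma eval_star_q_word:
  fixes h :: "rat poly \<Rightarrow> complex"
  assumes "coeff_hom h" "h hbar = 1 - q" "is_index v" "is_index w"
  shows "coeff_hom.eval h (star_sum (zeta_term q) n) (star_q_word v w) =
    star_sum (zeta_term q) n v * star_sum (zeta_term q) n w"
proof -
  interpret coeff_hom h by fact
  show ?thesis
    using assms(3,4)
  proof (induction v w arbitrary: n rule: star_q_word.induct)
    case (3 k v l w)
    have pos: "k > 0" "l > 0" "is_index v" "is_index w" "is_index (k # v)" "is_index (l # w)"
      using "3.prems" by (auto simp: is_index_def)
    let ?Z = "\<lambda>m. star_sum (zeta_term q) (Suc m)"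
    have *: "zeta_term q k m * zeta_term q l m * x =
        zeta_term q (k + l) m * x + (1 - q) * (zeta_term q (k + l - 1) m * x)" for m x
      unfolding zeta_term_mult[OF pos(1,2)] by (simp add: algebra_simps)
    show ?case
      unfolding star_q_word.simps distrib_right scale_mult_left eval_minus eval_add eval_scale
        eval_star_sum_letter_mult star_sum_mult * assms(2)
      using "3.IH" pos
      by (simp add: sum.distrib sum_distrib_left[symmetric])
  qed simp_all
qed

interpretation rat: coeff_hom "of_rat :: rat \<Rightarrow> complex"
  by standard (simp_all add: of_rat_add of_rat_mult)

definition hbar_eval :: "complex \<Rightarrow> rat poly \<Rightarrow> complex" where
  "hbar_eval x c = poly (map_poly of_rat c) x"

interpretation hbar: coeff_hom "hbar_eval x" for x
proof
  have "map_poly of_rat (a + b) = map_poly of_rat a + (map_poly of_rat b :: complex poly)" for a b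
    by (rule poly_eqI) (simp add: coeff_map_poly of_rat_add)
  then show "hbar_eval x (a + b) = hbar_eval x a + hbar_eval x b" for a b
    by (simp add: hbar_eval_def)
  have "map_poly of_rat (a * b) = map_poly of_rat a * (map_poly of_rat b :: complex poly)" for a b
    by (rule poly_eqI) (simp add: coeff_map_poly coeff_mult of_rat_sum of_rat_mult)
  then show "hbar_eval x (a * b) = hbar_eval x a * hbar_eval x b" for a b
    by (simp add: hbar_eval_def)
qed (simp add: hbar_eval_def)

lemma hbar_eval_hbar [simp]: "hbar_eval x hbar = x"
  by (simp add: hbar_eval_def hbar_def map_poly_pCons)

lemma hbar_eval_const: "hbar_eval x [:c:] = of_rat c"
  by (simp add: hbar_eval_def map_poly_pCons)

lemma hbar_eval_altdef: "hbar_eval x c = (\<Sum>i\<le>degree c. of_rat (coeff c i) * x ^ i)"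
  by (simp add: hbar_eval_def poly_altdef degree_map_poly coeff_map_poly)

lemma lookup_const_embed: "Poly_Mapping.lookup (const_embed w) a = [:Poly_Mapping.lookup w a:]"
  unfolding const_embed_def by (simp add: Poly_Mapping.map.rep_eq when_def)

lemma keys_const_embed: "Poly_Mapping.keys (const_embed w) = Poly_Mapping.keys w"
  by (auto simp: in_keys_iff lookup_const_embed)

lemma eval_const_embed: "hbar.eval x F (const_embed w) = rat.eval F w"
  by (simp add: hbar.eval_def rat.eval_def keys_const_embed lookup_const_embed hbar_eval_const)

abbreviation Z_eval :: "complex \<Rightarrow> nat \<Rightarrow> H1 \<Rightarrow> complex" where
  "Z_eval q n \<equiv> rat.eval (\<lambda>ks. z_star n ks q)"

abbreviation Z_eval_hat :: "complex \<Rightarrow> nat \<Rightarrow> H1hat \<Rightarrow> complex" where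
  "Z_eval_hat q n \<equiv> hbar.eval (1 - q) (\<lambda>ks. z_star n ks q)"

lemma Z_eval_hat_star_q:
  assumes "Poly_Mapping.keys v \<subseteq> Collect is_index" "Poly_Mapping.keys w \<subseteq> Collect is_index"
  shows "Z_eval_hat q n (star_q (const_embed v) (const_embed w)) = Z_eval q n v * Z_eval q n w"
proof -
  have z: "(\<lambda>ks. z_star n ks q) = star_sum (zeta_term q) n"
    by (simp add: z_star_eq_star_sum fun_eq_iff)
  have "Z_eval_hat q n (star_q (const_embed v) (const_embed w)) =
    rat.eval (\<lambda>a. rat.eval (\<lambda>b. z_star n a q * z_star n b q) w) v"
    unfolding star_q_def hbar.eval_bilinear_ext eval_const_embed
    using assms eval_star_q_word[OF hbar.coeff_hom_axioms, of "1 - q" q _ _ n]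
    by (intro rat.eval_cong) (auto simp: z z_star_eq_star_sum)
  then show ?thesis by (simp add: rat.eval_mult_left rat.eval_mult_right)
qed

text \<open>Compared with \<^const>\<open>star_q_word\<close>, the product \<^const>\<open>star_word\<close> omits the terms with
\<open>\<hbar>\<close>. When one factor is \<open>e\<^sub>1\<close>, each letter of the other contributes one such term, and
that term is the other factor itself.\<close>

lemma eval_star_word_one:
  assumes "is_index ks"
  shows "Z_eval q n (star_word [1] ks) =
    (z_star n [1] q + of_nat (dep ks) * (1 - q)) * z_star n ks q"
  using assms unfolding z_star_eq_star_sum
proof (induction ks arbitrary: n)
  case (Cons l w)
  let ?S = "star_sum (zeta_term q)"
  have pos: "l > 0" "is_index w" using Cons.prems by (auto simp: is_index_def)
  have *: "zeta_term q 1 m * zeta_term q l m * x =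
      zeta_term q (1 + l) m * x + (1 - q) * (zeta_term q l m * x)" for m x
    unfolding zeta_term_mult[OF zero_less_one pos(1)] by (simp add: algebra_simps)
  have prod_eq: "?S n [1] * ?S n (l # w) =
      ?S n (1 # l # w) + (\<Sum>m\<in>{0<..<n}. zeta_term q l m * (?S (Suc m) [1] * ?S (Suc m) w))
      - ?S n ((1 + l) # w) - (1 - q) * ?S n (l # w)"
    unfolding star_sum_mult *
    by (simp add: sum.distrib sum_distrib_left[symmetric] star_sum_Cons[of _ n])
  have eval_eq: "rat.eval (?S n) (star_word [1] (l # w)) =
      ?S n (1 # l # w) + (\<Sum>m\<in>{0<..<n}. zeta_term q l m * (?S (Suc m) [1] * ?S (Suc m) w))
      + of_nat (dep w) * (1 - q) * ?S n (l # w) - ?S n ((1 + l) # w)"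
    using Cons.IH[OF pos(2)]
    by (simp add: rat.eval_minus rat.eval_add rat.eval_star_sum_letter_mult star_sum_Cons[of _ n]
        distrib_right distrib_left sum.distrib sum_distrib_left mult_ac)
  show ?case
    unfolding eval_eq distrib_right prod_eq by (simp add: algebra_simps)
qed simp

text \<open>Pair \<open>m\<close> with \<open>n - m\<close>: the two values of \<open>1 / (1 - z\<^sup>m)\<close> add up to \<open>1\<close>.\<close>

lemma z_star_1:
  assumes z: "primitive_root_of_unity n z" and "n > 1"
  shows "z_star n [1] z = (1 - z) * (of_nat n - 1) / 2"
proof -
  have zn: "z ^ n = 1" and ne: "\<And>m. 0 < m \<Longrightarrow> m < n \<Longrightarrow> z ^ m \<noteq> 1"
    using z by (auto simp: primitive_root_of_unity_def)
  have z0: "z \<noteq> 0" using zn assms(2) by (auto simp: power_0_left)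
  have pair: "1 / (1 - w) + 1 / (1 - 1 / w) = 1" if "w \<noteq> 0" "w \<noteq> 1" for w :: complex
  proof -
    have "1 / (1 - 1 / w) = w / (w - 1)" "1 / (1 - w) = - 1 / (w - 1)"
      using that by (simp_all add: field_simps)
    then show ?thesis using that by (simp add: diff_divide_distrib[symmetric])
  qed
  define u where "u = (\<lambda>m. 1 / (1 - z ^ m))"
  have "bij_betw (\<lambda>m. n - m) {0<..<n} {0<..<n}"
    by (rule bij_betw_byWitness[where f' = "\<lambda>m. n - m"]) auto
  then have "(\<Sum>m\<in>{0<..<n}. u m) = (\<Sum>m\<in>{0<..<n}. u (n - m))"
    by (rule sum.reindex_bij_betw[symmetric])
  then have "2 * (\<Sum>m\<in>{0<..<n}. u m) = (\<Sum>m\<in>{0<..<n}. u m + u (n - m))"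
    by (simp add: sum.distrib)
  also have "\<dots> = (\<Sum>m\<in>{0<..<n}. 1)"
  proof (intro sum.cong refl)
    fix m assume m: "m \<in> {0<..<n}"
    have "z ^ (n - m) * z ^ m = 1" using m zn by (simp add: power_add[symmetric])
    then have inv: "z ^ (n - m) = 1 / z ^ m" using z0 by (simp add: field_simps)
    have "z ^ m \<noteq> 1" using ne m by auto
    then show "u m + u (n - m) = 1"
      using z0 unfolding u_def inv by (intro pair) auto
  qed
  also have "\<dots> = of_nat n - 1"
    using assms(2) by (simp add: of_nat_diff)
  finally have "(\<Sum>m\<in>{0<..<n}. u m) = (of_nat n - 1) / 2"
    by (metis nonzero_mult_div_cancel_left zero_neq_numeral)
  moreover have "z_star n [1] z = (1 - z) * (\<Sum>m\<in>{0<..<n}. u m)"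
    unfolding z_star_eq_star_sum star_sum_Cons
    by (simp add: zeta_term_def q_int_def u_def sum_distrib_left)
  ultimately show ?thesis by simp
qed

text \<open>The normalisation of \<^const>\<open>L_star\<close> cancels the factor
\<open>dep(\<^bold>k) + (n - 1)/2\<close> up to an error divisible by \<open>n\<close>.\<close>

lemma Z_eval_L_star_word:
  assumes "primitive_root_of_unity n z" "n > 1" "is_index ks"
  shows "Z_eval z n (L_star (word ks)) =
    (1 - z) * z_star n ks z + of_rat (1 / (2 * of_nat (dep ks) - 1)) * (of_nat n * ((1 - z) * z_star n ks z))"
proof -
  define d :: complex where "d = 2 * of_nat (dep ks) - 1"
  \<comment> \<open>The depth may be zero, so the denominator is non-zero by parity and not by size.\<close>
  have "complex_of_int (2 * int (dep ks) - 1) \<noteq> 0"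
    unfolding of_int_eq_0_iff by presburger
  then have d: "d \<noteq> 0" by (simp add: d_def)
  have r: "of_rat (2 / (2 * of_nat (dep ks) - 1)) = 2 / d" "of_rat (1 / (2 * of_nat (dep ks) - 1)) = 1 / d"
    by (simp_all add: d_def of_rat_divide of_rat_diff of_rat_mult)
  have "Z_eval z n (L_star (word ks)) = 2 / d * Z_eval z n (star_word [1] ks)"
    by (simp add: L_star_def rat.eval_scale r star_def bilinear_ext_def)
  also have "\<dots> = 2 / d * ((1 - z) * (of_nat n - 1) / 2 + of_nat (dep ks) * (1 - z)) * z_star n ks z"
    unfolding eval_star_word_one[OF assms(3)] z_star_1[OF assms(1,2)] by simp
  also have "(1 - z) * (of_nat n - 1) / 2 + of_nat (dep ks) * (1 - z) = (1 - z) * (d + of_nat n) / 2"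
    by (simp add: d_def field_simps)
  also have "2 / d * ((1 - z) * (d + of_nat n) / 2) * z_star n ks z =
      (1 - z) * z_star n ks z + 1 / d * (of_nat n * ((1 - z) * z_star n ks z))"
    using d by (simp add: field_simps)
  finally show ?thesis by (simp only: r)
qed

section \<open>Supports of the products\<close>

abbreviation indices :: "nat list set" where "indices \<equiv> {ks. is_index ks}"
abbreviation nonempty_indices :: "nat list set" where "nonempty_indices \<equiv> {ks. is_index ks \<and> ks \<noteq> []}"

lemma keys_add_le:
  "Poly_Mapping.keys v \<subseteq> A \<Longrightarrow> Poly_Mapping.keys w \<subseteq> A \<Longrightarrow> Poly_Mapping.keys (v + w) \<subseteq> A"
  using keys_add[of v w] by blast

lemma keys_minus_le:
  "Poly_Mapping.keys v \<subseteq> A \<Longrightarrow> Poly_Mapping.keys w \<subseteq> A \<Longrightarrow>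
    Poly_Mapping.keys (v - w :: 'a \<Rightarrow>\<^sub>0 'c::ab_group_add) \<subseteq> A"
  using keys_minus_subset[of v w] by blast

lemma keys_scale_le: "Poly_Mapping.keys w \<subseteq> A \<Longrightarrow> Poly_Mapping.keys (scale c w) \<subseteq> A"
  using keys_scale[of c w] by blast

lemma keys_letter_mult_index:
  assumes "Poly_Mapping.keys w \<subseteq> indices" "k > 0"
  shows "Poly_Mapping.keys (word [k] * w :: nat list \<Rightarrow>\<^sub>0 'c::comm_ring_1) \<subseteq> nonempty_indices"
proof
  fix ks assume "ks \<in> Poly_Mapping.keys (word [k] * w)"
  then obtain ls where "ks = k # ls" "ls \<in> Poly_Mapping.keys w"
    using keys_letter_mult[of k w] by auto
  then show "ks \<in> nonempty_indices" using assms by (auto simp: is_index_def)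
qed

text \<open>The formulas for \<^const>\<open>z_star\<close> need positive entries, and duality needs non-empty words, so
both properties have to be tracked through all products.\<close>

lemma keys_star_word:
  "is_index v \<Longrightarrow> is_index w \<Longrightarrow>
    Poly_Mapping.keys (star_word v w) \<subseteq> {ks. is_index ks \<and> (v \<noteq> [] \<or> w \<noteq> [] \<longrightarrow> ks \<noteq> [])}"
proof (induction v w rule: star_word.induct)
  case (3 k v l w)
  have pos: "k > 0" "l > 0" "is_index v" "is_index w"
    using "3.prems" by (auto simp: is_index_def)
  have "Poly_Mapping.keys (star_word (k # v) (l # w)) \<subseteq> nonempty_indices"
    unfolding star_word.simps using "3.IH" "3.prems" pos
    by (intro keys_minus_le keys_add_le keys_letter_mult_index; force)
  then show ?case by auto
qed auto

lemma keys_star_q_word: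
  "is_index v \<Longrightarrow> is_index w \<Longrightarrow>
    Poly_Mapping.keys (star_q_word v w) \<subseteq> {ks. is_index ks \<and> (v \<noteq> [] \<or> w \<noteq> [] \<longrightarrow> ks \<noteq> [])}"
proof (induction v w rule: star_q_word.induct)
  case (3 k v l w)
  have pos: "k > 0" "l > 0" "k + l - 1 > 0" "is_index v" "is_index w"
    using "3.prems" by (auto simp: is_index_def)
  have "Poly_Mapping.keys (star_q_word (k # v) (l # w)) \<subseteq> nonempty_indices"
    unfolding star_q_word.simps distrib_right scale_mult_left using "3.IH" "3.prems" pos
    by (intro keys_minus_le keys_add_le keys_scale_le keys_letter_mult_index; force)
  then show ?case by auto
qed auto

lemma keys_bilinear_ext:
  "Poly_Mapping.keys (bilinear_ext f v w) \<subseteq>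
    (\<Union>a\<in>Poly_Mapping.keys v. \<Union>b\<in>Poly_Mapping.keys w. Poly_Mapping.keys (f a b))"
  unfolding bilinear_ext_def
  by (rule order.trans[OF keys_linear_ext]) (intro UN_mono order.refl keys_linear_ext)

lemma keys_L_star:
  assumes "Poly_Mapping.keys w \<subseteq> indices"
  shows "Poly_Mapping.keys (L_star w) \<subseteq> nonempty_indices"
proof -
  have "Poly_Mapping.keys (scale c (star (word [1]) (word ks))) \<subseteq> nonempty_indices" if "is_index ks" for c ks
    using keys_scale[of c "star (word [1]) (word ks)"] keys_star_word[of "[1]" ks] that
    by (auto simp: star_def bilinear_ext_def is_index_def)
  then show ?thesis
    unfolding L_star_def using assms by (intro order.trans[OF keys_linear_ext] UN_least) auto
qed

lemma keys_L_star_power: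
  assumes "is_index ks"
  shows "Poly_Mapping.keys ((L_star ^^ i) (word ks)) \<subseteq> {ls. is_index ls \<and> (ks \<noteq> [] \<longrightarrow> ls \<noteq> [])}"
proof (induction i)
  case 0
  show ?case using assms by simp
next
  case (Suc i)
  then have "Poly_Mapping.keys ((L_star ^^ i) (word ks)) \<subseteq> indices" by auto
  from keys_L_star[OF this] show ?case by auto
qed

lemma keys_rho_star:
  assumes "Poly_Mapping.keys w \<subseteq> nonempty_indices"
  shows "Poly_Mapping.keys (rho_star w) \<subseteq> nonempty_indices"
  unfolding rho_star_def
proof (intro order.trans[OF keys_sum_subset] UN_least order.trans[OF keys_scale])
  fix ks i assume "ks \<in> Poly_Mapping.keys w"
  then show "Poly_Mapping.keys ((L_star ^^ i) (word ks)) \<subseteq> nonempty_indices"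
    using assms keys_L_star_power[of ks i] by auto
qed

lemma keys_star_q_const_embed:
  assumes "Poly_Mapping.keys v \<subseteq> nonempty_indices" "Poly_Mapping.keys w \<subseteq> nonempty_indices"
  shows "Poly_Mapping.keys (star_q (const_embed v) (const_embed w)) \<subseteq> nonempty_indices"
proof -
  have "Poly_Mapping.keys (star_q_word a b) \<subseteq> nonempty_indices"
    if "a \<in> Poly_Mapping.keys v" "b \<in> Poly_Mapping.keys w" for a b
    using keys_star_q_word[of a b] that assms by auto
  then show ?thesis
    unfolding star_q_def
    by (intro order.trans[OF keys_bilinear_ext] UN_least) (simp add: keys_const_embed)
qed

lemma keys_star_tilde:
  assumes "Poly_Mapping.keys v \<subseteq> nonempty_indices" "Poly_Mapping.keys w \<subseteq> nonempty_indices"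
  shows "Poly_Mapping.keys (star_tilde v w) \<subseteq> nonempty_indices"
  unfolding star_tilde_def by (intro keys_rho_star keys_star_q_const_embed assms)

lemma keys_delta: "Poly_Mapping.keys (delta w) \<subseteq> nonempty_indices"
proof -
  have "Poly_Mapping.keys (scale c (word (rev (hoffman_dual ks)))) \<subseteq> nonempty_indices" for c :: rat and ks
    using keys_scale[of c "word (rev (hoffman_dual ks))"] hoffman_dual_props(1)[of ks]
      hoffman_dual_nonempty[of ks] by (auto simp: is_index_def)
  then show ?thesis
    unfolding delta_def by (intro order.trans[OF keys_linear_ext] UN_least) simp
qed

lemma Z_eval_delta:
  assumes "primitive_root_of_unity n z" "Poly_Mapping.keys w \<subseteq> nonempty_indices"
  shows "Z_eval z n (delta w) = Z_eval z n w"
  unfolding delta_def rat.eval_linear_ext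
  using assms z_star_duality[OF assms(1)]
  by (intro rat.eval_cong) (auto simp: rat.eval_scale of_rat_power of_rat_minus)

section \<open>Negligible families\<close>

text \<open>One integer \<open>N\<close> serves all primes at once; this makes the notion stable under rational
scalars without discarding finitely many primes.\<close>

definition negligible :: "(nat \<Rightarrow> complex) \<Rightarrow> (nat \<Rightarrow> complex) \<Rightarrow> bool" where
  "negligible \<zeta> f \<longleftrightarrow> (\<exists>N::nat. N > 0 \<and>
     (\<forall>p. prime p \<longrightarrow> (\<exists>x\<in>carrier (Z_adjoin (\<zeta> p)). of_nat N * f p = of_nat p * x)))"

lemma negligible_p_multiple:
  assumes "\<And>p. prime p \<Longrightarrow> x p \<in> carrier (Z_adjoin (\<zeta> p))"
  shows "negligible \<zeta> (\<lambda>p. of_nat p * x p)"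
  unfolding negligible_def using assms by (intro exI[of _ 1]) auto

lemma negligible_cong:
  "negligible \<zeta> f \<Longrightarrow> (\<And>p. prime p \<Longrightarrow> f p = g p) \<Longrightarrow> negligible \<zeta> g"
  unfolding negligible_def by metis

lemma negligible_0: "negligible \<zeta> (\<lambda>_. 0)"
  using negligible_p_multiple[of "\<lambda>_. 0" \<zeta>] by (simp add: Z_adjoin_0)

lemma negligible_add:
  assumes "negligible \<zeta> f" "negligible \<zeta> g"
  shows "negligible \<zeta> (\<lambda>p. f p + g p)"
proof -
  obtain M N x y where MN: "M > 0" "N > 0"
    and x: "\<And>p. prime p \<Longrightarrow> x p \<in> carrier (Z_adjoin (\<zeta> p)) \<and> of_nat M * f p = of_nat p * x p"
    and y: "\<And>p. prime p \<Longrightarrow> y p \<in> carrier (Z_adjoin (\<zeta> p)) \<and> of_nat N * g p = of_nat p * y p"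
    using assms unfolding negligible_def by metis
  have "\<exists>z\<in>carrier (Z_adjoin (\<zeta> p)). of_nat (M * N) * (f p + g p) = of_nat p * z" if "prime p" for p
  proof
    show "of_nat N * x p + of_nat M * y p \<in> carrier (Z_adjoin (\<zeta> p))"
      using x y that by (intro Z_adjoin_add Z_adjoin_mult Z_adjoin_of_nat) auto
    have "of_nat (M * N) * (f p + g p) = of_nat N * (of_nat M * f p) + of_nat M * (of_nat N * g p)"
      by (simp add: algebra_simps)
    also have "\<dots> = of_nat p * (of_nat N * x p + of_nat M * y p)"
      using x[OF that] y[OF that] by (simp add: algebra_simps)
    finally show "of_nat (M * N) * (f p + g p) = of_nat p * (of_nat N * x p + of_nat M * y p)" .
  qed
  then show ?thesis
    unfolding negligible_def using MN by (intro exI[of _ "M * N"]) simp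
qed

lemma negligible_sum:
  assumes "\<And>i. i \<in> I \<Longrightarrow> negligible \<zeta> (f i)"
  shows "negligible \<zeta> (\<lambda>p. \<Sum>i\<in>I. f i p)"
  using assms
  by (induction I rule: infinite_finite_induct) (simp_all add: negligible_0 negligible_add)

lemma negligible_mult:
  assumes "negligible \<zeta> f" "\<And>p. prime p \<Longrightarrow> c p \<in> carrier (Z_adjoin (\<zeta> p))"
  shows "negligible \<zeta> (\<lambda>p. c p * f p)"
proof -
  obtain N x where N: "N > 0"
    and x: "\<And>p. prime p \<Longrightarrow> x p \<in> carrier (Z_adjoin (\<zeta> p)) \<and> of_nat N * f p = of_nat p * x p"
    using assms unfolding negligible_def by metis
  have "\<exists>z\<in>carrier (Z_adjoin (\<zeta> p)). of_nat N * (c p * f p) = of_nat p * z" if "prime p" for p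
    using x[OF that] assms(2)[OF that]
    by (intro bexI[of _ "c p * x p"] Z_adjoin_mult) (auto simp: mult.left_commute)
  then show ?thesis
    unfolding negligible_def using N by blast
qed

lemma negligible_diff:
  assumes "negligible \<zeta> f" "negligible \<zeta> g"
  shows "negligible \<zeta> (\<lambda>p. f p - g p)"
  using negligible_add[OF assms(1) negligible_mult[OF assms(2), of "\<lambda>_. -1"]]
  by (simp add: Z_adjoin_uminus Z_adjoin_1)

lemma negligible_rat:
  assumes "negligible \<zeta> f"
  shows "negligible \<zeta> (\<lambda>p. of_rat r * f p)"
proof -
  obtain a b where ab: "b > 0" "r = of_int a / of_int b"
    using quotient_of_div[of r] quotient_of_denom_pos'[of r] by (metis prod.collapse)
  define B where "B = nat b"
  have B: "B > 0" "of_nat B * of_rat r = (of_int a :: complex)"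
    using ab by (simp_all add: B_def of_rat_divide)
  obtain N x where N: "N > 0"
    and x: "\<And>p. prime p \<Longrightarrow> x p \<in> carrier (Z_adjoin (\<zeta> p)) \<and> of_nat N * f p = of_nat p * x p"
    using assms unfolding negligible_def by metis
  have "\<exists>z\<in>carrier (Z_adjoin (\<zeta> p)). of_nat (B * N) * (of_rat r * f p) = of_nat p * z" if "prime p" for p
  proof
    show "of_int a * x p \<in> carrier (Z_adjoin (\<zeta> p))"
      using x[OF that] by (intro Z_adjoin_mult Z_adjoin_of_int) auto
    have "of_nat (B * N) * (of_rat r * f p) = of_nat B * of_rat r * (of_nat N * f p)"
      by (simp add: mult_ac)
    also have "\<dots> = of_nat p * (of_int a * x p)"
      unfolding B(2) using x[OF that] by (simp add: mult_ac)
    finally show "of_nat (B * N) * (of_rat r * f p) = of_nat p * (of_int a * x p)" .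
  qed
  then show ?thesis
    unfolding negligible_def using N B(1) by (intro exI[of _ "B * N"]) simp
qed

context
  fixes \<zeta> :: "nat \<Rightarrow> complex"
  assumes root: "\<And>p. prime p \<Longrightarrow> primitive_root_of_unity p (\<zeta> p)"
begin

lemma one_minus_root_integral: "1 - \<zeta> p \<in> carrier (Z_adjoin (\<zeta> p))"
  using Z_adjoin_add[OF Z_adjoin_1 Z_adjoin_uminus[OF Z_adjoin_gen]] by simp

text \<open>The errors are those of \<open>Z_eval_L_star_word\<close>: \<open>p\<close> times an integral family, up to rational
scalars that are independent of \<open>p\<close>.\<close>

lemma L_star_approx:
  assumes "Poly_Mapping.keys w \<subseteq> indices"
  shows "negligible \<zeta> (\<lambda>p. Z_eval (\<zeta> p) p (L_star w) - (1 - \<zeta> p) * Z_eval (\<zeta> p) p w)"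
proof (rule negligible_cong)
  let ?r = "\<lambda>ks. 1 / (2 * of_nat (dep ks) - 1) :: rat"
  show "negligible \<zeta> (\<lambda>p. \<Sum>ks\<in>Poly_Mapping.keys w. of_rat (Poly_Mapping.lookup w ks) *
      (of_rat (?r ks) * (of_nat p * ((1 - \<zeta> p) * z_star p ks (\<zeta> p)))))"
    by (intro negligible_sum negligible_rat negligible_p_multiple Z_adjoin_mult
        one_minus_root_integral z_star_in_Z_adjoin root)
  fix p :: nat assume p: "prime p"
  have L: "L_star w = linear_ext (\<lambda>ks. L_star (word ks)) w"
    by (simp add: L_star_def)
  have "Z_eval (\<zeta> p) p (L_star w) - (1 - \<zeta> p) * Z_eval (\<zeta> p) p w =
    (\<Sum>ks\<in>Poly_Mapping.keys w. of_rat (Poly_Mapping.lookup w ks) *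
       (Z_eval (\<zeta> p) p (L_star (word ks)) - (1 - \<zeta> p) * z_star p ks (\<zeta> p)))"
    by (subst L) (simp add: rat.eval_linear_ext rat.eval_def[of _ w] sum_distrib_left
        sum_subtractf[symmetric] right_diff_distrib mult.left_commute)
  also have "\<dots> = (\<Sum>ks\<in>Poly_Mapping.keys w. of_rat (Poly_Mapping.lookup w ks) *
      (of_rat (?r ks) * (of_nat p * ((1 - \<zeta> p) * z_star p ks (\<zeta> p)))))"
    using assms Z_eval_L_star_word[OF root[OF p] prime_gt_1_nat[OF p]]
    by (intro sum.cong refl) auto
  finally show "(\<Sum>ks\<in>Poly_Mapping.keys w. of_rat (Poly_Mapping.lookup w ks) *
      (of_rat (?r ks) * (of_nat p * ((1 - \<zeta> p) * z_star p ks (\<zeta> p))))) =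
      Z_eval (\<zeta> p) p (L_star w) - (1 - \<zeta> p) * Z_eval (\<zeta> p) p w" ..
qed

lemma L_star_power_approx:
  assumes "is_index ks"
  shows "negligible \<zeta> (\<lambda>p. Z_eval (\<zeta> p) p ((L_star ^^ i) (word ks)) - (1 - \<zeta> p) ^ i * z_star p ks (\<zeta> p))"
proof (induction i)
  case 0
  show ?case by (simp add: negligible_0)
next
  case (Suc i)
  have "Poly_Mapping.keys ((L_star ^^ i) (word ks)) \<subseteq> indices"
    using keys_L_star_power[OF assms, of i] by auto
  from negligible_add[OF L_star_approx[OF this] negligible_mult[OF Suc one_minus_root_integral]]
  show ?case by (simp add: right_diff_distrib mult.assoc)
qed

lemma rho_star_approx:
  assumes "Poly_Mapping.keys w \<subseteq> indices"
  shows "negligible \<zeta> (\<lambda>p. Z_eval (\<zeta> p) p (rho_star w) - Z_eval_hat (\<zeta> p) p w)"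
proof (rule negligible_cong)
  let ?c = "\<lambda>ks i. of_rat (coeff (Poly_Mapping.lookup w ks) i) :: complex"
  show "negligible \<zeta> (\<lambda>p. \<Sum>ks\<in>Poly_Mapping.keys w. \<Sum>i\<le>degree (Poly_Mapping.lookup w ks).
      ?c ks i * (Z_eval (\<zeta> p) p ((L_star ^^ i) (word ks)) - (1 - \<zeta> p) ^ i * z_star p ks (\<zeta> p)))"
    using assms by (intro negligible_sum negligible_rat L_star_power_approx) auto
  show "(\<Sum>ks\<in>Poly_Mapping.keys w. \<Sum>i\<le>degree (Poly_Mapping.lookup w ks).
      ?c ks i * (Z_eval (\<zeta> p) p ((L_star ^^ i) (word ks)) - (1 - \<zeta> p) ^ i * z_star p ks (\<zeta> p))) =
      Z_eval (\<zeta> p) p (rho_star w) - Z_eval_hat (\<zeta> p) p w" for p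
    by (simp add: rho_star_def rat.eval_sum rat.eval_scale hbar.eval_def hbar_eval_altdef
        sum_distrib_right right_diff_distrib sum_subtractf mult.assoc)
qed

text \<open>Multiplicativity of \<open>Z\<^sup>\<star>\<close> for \<^const>\<open>star_tilde\<close>, at the level of families.\<close>

lemma star_tilde_approx:
  assumes "Poly_Mapping.keys v \<subseteq> nonempty_indices" "Poly_Mapping.keys w \<subseteq> nonempty_indices"
  shows "negligible \<zeta> (\<lambda>p. Z_eval (\<zeta> p) p (star_tilde v w) - Z_eval (\<zeta> p) p v * Z_eval (\<zeta> p) p w)"
proof -
  have "Poly_Mapping.keys v \<subseteq> indices" "Poly_Mapping.keys w \<subseteq> indices"
    "Poly_Mapping.keys (star_q (const_embed v) (const_embed w)) \<subseteq> indices"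
    using assms keys_star_q_const_embed[OF assms] by auto
  then show ?thesis
    using rho_star_approx[of "star_q (const_embed v) (const_embed w)"]
    by (simp add: star_tilde_def Z_eval_hat_star_q)
qed

end

section \<open>Passage to the ring \<open>\<A>\<^sup>c\<^sup>y\<^sup>c\<close>\<close>

definition Acyc_class :: "(nat \<Rightarrow> complex) \<Rightarrow> (nat \<Rightarrow> complex) \<Rightarrow> (nat \<Rightarrow> complex set) set" where
  "Acyc_class \<zeta> x =
     direct_sum {p. prime p} (residue_p \<zeta>) +>\<^bsub>product_ring {p. prime p} (residue_p \<zeta>)\<^esub>
       (\<lambda>p\<in>{p. prime p}. principal_p \<zeta> p +>\<^bsub>Z_adjoin (\<zeta> p)\<^esub> x p)"

definition integral :: "(nat \<Rightarrow> complex) \<Rightarrow> (nat \<Rightarrow> complex) \<Rightarrow> bool" where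
  "integral \<zeta> x \<longleftrightarrow> (\<forall>p. prime p \<longrightarrow> x p \<in> carrier (Z_adjoin (\<zeta> p)))"

lemma integral_add: "integral \<zeta> x \<Longrightarrow> integral \<zeta> y \<Longrightarrow> integral \<zeta> (\<lambda>p. x p + y p)"
  and integral_mult: "integral \<zeta> x \<Longrightarrow> integral \<zeta> y \<Longrightarrow> integral \<zeta> (\<lambda>p. x p * y p)"
  and integral_of_int: "integral \<zeta> (\<lambda>_. of_int a)"
  and integral_of_nat: "integral \<zeta> (\<lambda>_. of_nat n)"
  and integral_0: "integral \<zeta> (\<lambda>_. 0)" and integral_1: "integral \<zeta> (\<lambda>_. 1)"
  by (simp_all add: integral_def Z_adjoin_add Z_adjoin_mult Z_adjoin_of_int Z_adjoin_of_nat
      Z_adjoin_0 Z_adjoin_1)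

lemma integral_sum: "(\<And>i. i \<in> I \<Longrightarrow> integral \<zeta> (x i)) \<Longrightarrow> integral \<zeta> (\<lambda>p. \<Sum>i\<in>I. x i p)"
  by (induction I rule: infinite_finite_induct) (simp_all add: integral_0 integral_add)

context
  fixes \<zeta> :: "nat \<Rightarrow> complex"
begin

interpretation A: cring "Acyc \<zeta>" by (rule Acyc_cring)

abbreviation "cls \<equiv> Acyc_class \<zeta>"

lemma residue_hom:
  "(+>\<^bsub>Z_adjoin (\<zeta> p)\<^esub>) (principal_p \<zeta> p) \<in> ring_hom (Z_adjoin (\<zeta> p)) (residue_p \<zeta> p)"
  unfolding residue_p_def by (rule ideal.rcos_ring_hom[OF principal_p_ideal])

lemma quotient_hom:
  "(+>\<^bsub>product_ring {p. prime p} (residue_p \<zeta>)\<^esub>) (direct_sum {p. prime p} (residue_p \<zeta>))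
     \<in> ring_hom (product_ring {p. prime p} (residue_p \<zeta>)) (Acyc \<zeta>)"
  unfolding Acyc_def
  by (rule ideal.rcos_ring_hom[OF direct_sum_ideal[OF residue_p_cring]])

lemma residues_carrier:
  "integral \<zeta> x \<Longrightarrow> (\<lambda>p\<in>{p. prime p}. principal_p \<zeta> p +>\<^bsub>Z_adjoin (\<zeta> p)\<^esub> x p)
     \<in> carrier (product_ring {p. prime p} (residue_p \<zeta>))"
  by (auto simp: product_ring_def integral_def intro!: ring_hom_closed[OF residue_hom])

lemma Acyc_class_closed: "integral \<zeta> x \<Longrightarrow> cls x \<in> carrier (Acyc \<zeta>)"
  unfolding Acyc_class_def by (intro ring_hom_closed[OF quotient_hom] residues_carrier)

lemma Acyc_class_cong: "(\<And>p. prime p \<Longrightarrow> x p = y p) \<Longrightarrow> cls x = cls y"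
  unfolding Acyc_class_def by (intro arg_cong[where f = "(+>\<^bsub>R\<^esub>) I" for R I] restrict_ext) simp

lemma Acyc_class_add:
  assumes "integral \<zeta> x" "integral \<zeta> y"
  shows "cls (\<lambda>p. x p + y p) = cls x \<oplus>\<^bsub>Acyc \<zeta>\<^esub> cls y"
  unfolding Acyc_class_def
  using assms ring_hom_add[OF residue_hom]
  by (subst ring_hom_add[OF quotient_hom residues_carrier residues_carrier, symmetric])
    (auto simp: product_ring_def integral_def intro!: arg_cong[where f = "(+>\<^bsub>R\<^esub>) I" for R I] restrict_ext)

lemma Acyc_class_mult:
  assumes "integral \<zeta> x" "integral \<zeta> y"
  shows "cls (\<lambda>p. x p * y p) = cls x \<otimes>\<^bsub>Acyc \<zeta>\<^esub> cls y"
  unfolding Acyc_class_def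
  using assms ring_hom_mult[OF residue_hom]
  by (subst ring_hom_mult[OF quotient_hom residues_carrier residues_carrier, symmetric])
    (auto simp: product_ring_def integral_def intro!: arg_cong[where f = "(+>\<^bsub>R\<^esub>) I" for R I] restrict_ext)

lemma Acyc_class_1: "cls (\<lambda>_. 1) = \<one>\<^bsub>Acyc \<zeta>\<^esub>"
  unfolding Acyc_class_def ring_hom_one[OF quotient_hom, symmetric]
  using ring_hom_one[OF residue_hom]
  by (auto simp: product_ring_def intro!: arg_cong[where f = "(+>\<^bsub>R\<^esub>) I" for R I] restrict_ext)

lemma Acyc_class_p_multiple:
  assumes "integral \<zeta> x"
  shows "cls (\<lambda>p. of_nat p * x p) = \<zero>\<^bsub>Acyc \<zeta>\<^esub>"
proof -
  let ?P = "product_ring {p. prime p} (residue_p \<zeta>)" and ?D = "direct_sum {p. prime p} (residue_p \<zeta>)"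
  interpret D: ideal ?D ?P by (rule direct_sum_ideal) (rule residue_p_cring)
  have "principal_p \<zeta> p +>\<^bsub>Z_adjoin (\<zeta> p)\<^esub> (of_nat p * x p) = \<zero>\<^bsub>residue_p \<zeta> p\<^esub>" if "prime p" for p
  proof -
    interpret J: ideal "principal_p \<zeta> p" "Z_adjoin (\<zeta> p)" by (rule principal_p_ideal)
    have "of_nat p * x p \<in> principal_p \<zeta> p"
      unfolding principal_p_def cgenideal_def using that assms
      by (auto simp: integral_def intro!: exI[of _ "x p"])
    then show ?thesis
      using J.a_rcos_const by (simp add: residue_p_def FactRing_def)
  qed
  then have "cls (\<lambda>p. of_nat p * x p) = ?D +>\<^bsub>?P\<^esub> \<zero>\<^bsub>?P\<^esub>"
    unfolding Acyc_class_def
    by (auto simp: product_ring_def intro!: arg_cong[where f = "(+>\<^bsub>R\<^esub>) I" for R I] restrict_ext)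
  also have "\<dots> = ?D"
    by (rule D.a_rcos_const)
      (rule additive_subgroup.zero_closed[OF ideal.axioms(1)[OF D.ideal_axioms]])
  finally show ?thesis by (simp add: Acyc_def FactRing_def)
qed

lemma Acyc_class_0: "cls (\<lambda>_. 0) = \<zero>\<^bsub>Acyc \<zeta>\<^esub>"
  using Acyc_class_p_multiple[OF integral_0] by simp

lemma Acyc_class_sum:
  assumes "finite I" "\<And>i. i \<in> I \<Longrightarrow> integral \<zeta> (x i)"
  shows "(\<Oplus>\<^bsub>Acyc \<zeta>\<^esub>i\<in>I. cls (x i)) = cls (\<lambda>p. \<Sum>i\<in>I. x i p)"
  using assms
proof (induction I rule: finite_induct)
  case empty
  show ?case by (simp add: Acyc_class_0)
next
  case (insert i I)
  then have "(\<Oplus>\<^bsub>Acyc \<zeta>\<^esub>i\<in>insert i I. cls (x i)) = cls (x i) \<oplus>\<^bsub>Acyc \<zeta>\<^esub> cls (\<lambda>p. \<Sum>i\<in>I. x i p)"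
    by (subst A.finsum_insert) (auto intro!: Acyc_class_closed)
  with insert show ?case by (simp add: Acyc_class_add integral_sum)
qed

lemma Acyc_class_of_nat: "cls (\<lambda>_. of_nat n) = [n] \<cdot>\<^bsub>Acyc \<zeta>\<^esub> \<one>\<^bsub>Acyc \<zeta>\<^esub>"
proof (induction n)
  case 0
  show ?case by (simp add: Acyc_class_0)
next
  case (Suc n)
  have "cls (\<lambda>_. of_nat (Suc n)) = cls (\<lambda>_. of_nat n) \<oplus>\<^bsub>Acyc \<zeta>\<^esub> cls (\<lambda>_. 1)"
    by (subst Acyc_class_add[symmetric]) (simp_all add: integral_of_nat integral_1 add.commute)
  with Suc show ?case by (simp add: Acyc_class_1)
qed

lemma Acyc_class_of_int: "cls (\<lambda>_. of_int a) = [a] \<cdot>\<^bsub>Acyc \<zeta>\<^esub> \<one>\<^bsub>Acyc \<zeta>\<^esub>"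
proof (cases "a \<ge> 0")
  case True
  then show ?thesis
    using Acyc_class_of_nat[of "nat a"] by (simp add: add_pow_int_ge)
next
  case False
  have "cls (\<lambda>_. of_int a) \<oplus>\<^bsub>Acyc \<zeta>\<^esub> cls (\<lambda>_. of_nat (nat (- a))) = \<zero>\<^bsub>Acyc \<zeta>\<^esub>"
    using False integral_of_int[of \<zeta> "- a"]
    by (subst Acyc_class_add[symmetric]) (simp_all add: integral_of_nat integral_of_int Acyc_class_0)
  then have "cls (\<lambda>_. of_int a) = \<ominus>\<^bsub>Acyc \<zeta>\<^esub> cls (\<lambda>_. of_nat (nat (- a)))"
    by (intro A.minus_equality[symmetric] Acyc_class_closed integral_of_nat integral_of_int)
  then show ?thesis
    using False Acyc_class_of_nat[of "nat (- a)"] by (simp add: add_pow_int_lt)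
qed

lemma Acyc_class_of_nat_Units: "n > 0 \<Longrightarrow> cls (\<lambda>_. of_nat n) \<in> Units (Acyc \<zeta>)"
  unfolding Acyc_class_of_nat by (rule Acyc_of_nat_Units)

lemma rat_smult_closed:
  assumes "x \<in> carrier (Acyc \<zeta>)"
  shows "rat_smult (Acyc \<zeta>) r x \<in> carrier (Acyc \<zeta>)"
proof -
  obtain a b where r: "quotient_of r = (a, b)" by fastforce
  then have "b > 0" by (rule quotient_of_denom_pos)
  then have "[b] \<cdot>\<^bsub>Acyc \<zeta>\<^esub> \<one>\<^bsub>Acyc \<zeta>\<^esub> \<in> Units (Acyc \<zeta>)"
    using Acyc_of_nat_Units[of "nat b"] by (simp add: add_pow_int_ge)
  then show ?thesis using assms by (simp add: rat_smult_def r)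
qed

text \<open>Clearing denominators replaces \<^const>\<open>rat_smult\<close>, which is defined through inverses in
\<open>\<A>\<^sup>c\<^sup>y\<^sup>c\<close>, by multiplication of complex numbers.\<close>

lemma Acyc_class_mult_rat_smult:
  assumes x: "integral \<zeta> x" and N: "of_nat N * r = of_int m"
  shows "cls (\<lambda>_. of_nat N) \<otimes>\<^bsub>Acyc \<zeta>\<^esub> rat_smult (Acyc \<zeta>) r (cls x) = cls (\<lambda>p. of_int m * x p)"
proof -
  obtain a b where r: "quotient_of r = (a, b)" by fastforce
  then have b: "b > 0" and "r = of_int a / of_int b"
    by (rule quotient_of_denom_pos) (rule quotient_of_div[OF r])
  with N have "(of_int (int N * a) :: rat) = of_int (m * b)"
    by (simp add: field_simps)
  then have Na: "int N * a = m * b" by (simp only: of_int_eq_iff)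
  have b_unit: "cls (\<lambda>_. of_int b) \<in> Units (Acyc \<zeta>)"
    using Acyc_class_of_nat_Units[of "nat b"] b by simp
  note closed = Acyc_class_closed[OF integral_of_int] Acyc_class_closed[OF integral_of_nat]
    Acyc_class_closed[OF x] A.Units_inv_closed[OF b_unit]
  have "cls (\<lambda>_. of_nat N) \<otimes>\<^bsub>Acyc \<zeta>\<^esub> cls (\<lambda>_. of_int a) = cls (\<lambda>_. of_nat N * of_int a)"
    by (rule Acyc_class_mult[symmetric, OF integral_of_nat integral_of_int])
  also have "(\<lambda>_::nat. of_nat N * of_int a :: complex) = (\<lambda>_. of_int m * of_int b)"
    using arg_cong[OF Na, of "of_int :: int \<Rightarrow> complex"] by simp
  also have "cls \<dots> = cls (\<lambda>_. of_int m) \<otimes>\<^bsub>Acyc \<zeta>\<^esub> cls (\<lambda>_. of_int b)"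
    by (rule Acyc_class_mult[OF integral_of_int integral_of_int])
  finally have num: "cls (\<lambda>_. of_nat N) \<otimes>\<^bsub>Acyc \<zeta>\<^esub> cls (\<lambda>_. of_int a) =
    cls (\<lambda>_. of_int m) \<otimes>\<^bsub>Acyc \<zeta>\<^esub> cls (\<lambda>_. of_int b)" .
  have "cls (\<lambda>_. of_nat N) \<otimes>\<^bsub>Acyc \<zeta>\<^esub> rat_smult (Acyc \<zeta>) r (cls x) =
    (cls (\<lambda>_. of_nat N) \<otimes>\<^bsub>Acyc \<zeta>\<^esub> cls (\<lambda>_. of_int a)) \<otimes>\<^bsub>Acyc \<zeta>\<^esub> inv\<^bsub>Acyc \<zeta>\<^esub> cls (\<lambda>_. of_int b) \<otimes>\<^bsub>Acyc \<zeta>\<^esub> cls x"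
    using closed by (simp add: rat_smult_def r Acyc_class_of_int[symmetric] A.m_assoc)
  also have "\<dots> = cls (\<lambda>_. of_int m) \<otimes>\<^bsub>Acyc \<zeta>\<^esub> (cls (\<lambda>_. of_int b) \<otimes>\<^bsub>Acyc \<zeta>\<^esub> inv\<^bsub>Acyc \<zeta>\<^esub> cls (\<lambda>_. of_int b)) \<otimes>\<^bsub>Acyc \<zeta>\<^esub> cls x"
    unfolding num using closed by (simp add: A.m_assoc)
  also have "\<dots> = cls (\<lambda>_. of_int m) \<otimes>\<^bsub>Acyc \<zeta>\<^esub> cls x"
    using closed b_unit by simp
  finally show ?thesis
    by (simp only: Acyc_class_mult[OF integral_of_int x])
qed

lemma Z_star_eq_class: "Z_star \<zeta> ks = cls (\<lambda>p. z_star p ks (\<zeta> p))"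
  by (simp add: Z_star_def Acyc_class_def)

end

lemma common_denominator:
  "finite S \<Longrightarrow> \<exists>N::nat>0. \<forall>r\<in>S. \<exists>m::int. of_nat N * (r::rat) = of_int m"
proof (induction S rule: finite_induct)
  case empty
  show ?case by (intro exI[of _ 1]) simp
next
  case (insert r S)
  then obtain N where N: "N > 0" "\<forall>r\<in>S. \<exists>m::int. of_nat N * r = of_int m" by blast
  obtain a b where r: "quotient_of r = (a, b)" by fastforce
  have b: "b > 0" "r = of_int a / of_int b"
    using quotient_of_denom_pos[OF r] quotient_of_div[OF r] by auto
  have "\<exists>m::int. of_nat (N * nat b) * s = of_int m" if s: "s \<in> insert r S" for s
  proof (cases "s = r")
    case True
    have "of_nat (N * nat b) * s = of_int (int N * a)" using b True by simp
    then show ?thesis by blast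
  next
    case False
    then obtain m where "of_nat N * s = of_int m" using N s by blast
    then have "of_nat (N * nat b) * s = of_int (b * m)" using b by (simp add: algebra_simps)
    then show ?thesis by blast
  qed
  then show ?case using N(1) b(1) by (intro exI[of _ "N * nat b"]) simp
qed

text \<open>Multiply by a common denominator of the coefficients and by the integer from
\<^const>\<open>negligible\<close>: the result is the class of a family of multiples of \<open>p\<close>, and the multiplier is a
unit.\<close>

lemma Z_star_map_eq_0:
  assumes root: "\<And>p. prime p \<Longrightarrow> primitive_root_of_unity p (\<zeta> p)"
    and negl: "negligible \<zeta> (\<lambda>p. Z_eval (\<zeta> p) p w)"
  shows "Z_star_map \<zeta> w = \<zero>\<^bsub>Acyc \<zeta>\<^esub>"
proof -
  interpret A: cring "Acyc \<zeta>" by (rule Acyc_cring)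
  let ?K = "Poly_Mapping.keys w" and ?z = "\<lambda>ks p. z_star p ks (\<zeta> p)"
  have z: "integral \<zeta> (?z ks)" for ks
    by (simp add: integral_def z_star_in_Z_adjoin root)
  obtain M where M: "M > 0" "\<forall>r\<in>Poly_Mapping.lookup w ` ?K. \<exists>m::int. of_nat M * r = of_int m"
    using common_denominator[of "Poly_Mapping.lookup w ` ?K"] by auto
  obtain N y where N: "N > 0"
    and y: "\<And>p. prime p \<Longrightarrow> y p \<in> carrier (Z_adjoin (\<zeta> p)) \<and> of_nat N * Z_eval (\<zeta> p) p w = of_nat p * y p"
    using negl unfolding negligible_def by metis
  have "\<exists>m::int. of_nat (N * M) * Poly_Mapping.lookup w ks = of_int m" if ks: "ks \<in> ?K" for ks
  proof -
    obtain m :: int where "of_nat M * Poly_Mapping.lookup w ks = of_int m" using bspec[OF M(2) imageI[OF ks]] by blast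
    then have "of_nat (N * M) * Poly_Mapping.lookup w ks = of_int (int N * m)"
      by (simp add: mult.assoc)
    then show ?thesis by blast
  qed
  then obtain m where m: "\<And>ks. ks \<in> ?K \<Longrightarrow> of_nat (N * M) * Poly_Mapping.lookup w ks = of_int (m ks)"
    by metis
  let ?u = "Acyc_class \<zeta> (\<lambda>_. of_nat (N * M))"
  have u: "?u \<in> Units (Acyc \<zeta>)"
    using Acyc_class_of_nat_Units[of "N * M" \<zeta>] N M(1) by simp
  have terms: "(\<lambda>ks. rat_smult (Acyc \<zeta>) (Poly_Mapping.lookup w ks) (Z_star \<zeta> ks)) \<in> ?K \<rightarrow> carrier (Acyc \<zeta>)"
    by (auto simp: Z_star_eq_class intro!: rat_smult_closed Acyc_class_closed z)
  have "?u \<otimes>\<^bsub>Acyc \<zeta>\<^esub> Z_star_map \<zeta> w =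
    (\<Oplus>\<^bsub>Acyc \<zeta>\<^esub>ks\<in>?K. ?u \<otimes>\<^bsub>Acyc \<zeta>\<^esub> rat_smult (Acyc \<zeta>) (Poly_Mapping.lookup w ks) (Z_star \<zeta> ks))"
    unfolding Z_star_map_def using A.Units_closed[OF u] terms by (simp add: A.finsum_rdistr)
  also have "\<dots> = (\<Oplus>\<^bsub>Acyc \<zeta>\<^esub>ks\<in>?K. Acyc_class \<zeta> (\<lambda>p. of_int (m ks) * ?z ks p))"
    by (rule A.finsum_cong')
      (auto simp del: of_nat_mult simp: Z_star_eq_class Acyc_class_mult_rat_smult[OF z m]
        intro!: Acyc_class_closed integral_mult integral_of_int z)
  also have "\<dots> = Acyc_class \<zeta> (\<lambda>p. \<Sum>ks\<in>?K. of_int (m ks) * ?z ks p)"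
    by (intro Acyc_class_sum integral_mult integral_of_int z) simp
  also have "\<dots> = Acyc_class \<zeta> (\<lambda>p. of_nat p * (of_nat M * y p))"
  proof (rule Acyc_class_cong)
    fix p :: nat assume p: "prime p"
    have m': "of_int (m ks) = (of_nat (N * M) * of_rat (Poly_Mapping.lookup w ks) :: complex)" if "ks \<in> ?K" for ks
      using arg_cong[OF m[OF that], of "of_rat :: rat \<Rightarrow> complex"] by (simp add: of_rat_mult)
    have "(\<Sum>ks\<in>?K. of_int (m ks) * ?z ks p) = of_nat M * (of_nat N * Z_eval (\<zeta> p) p w)"
      unfolding rat.eval_def sum_distrib_left by (intro sum.cong refl) (simp add: m' mult_ac)
    also have "\<dots> = of_nat p * (of_nat M * y p)"
      using y[OF p] by (simp add: mult_ac)
    finally show "(\<Sum>ks\<in>?K. of_int (m ks) * ?z ks p) = of_nat p * (of_nat M * y p)" .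
  qed
  also have "\<dots> = \<zero>\<^bsub>Acyc \<zeta>\<^esub>"
    using y by (intro Acyc_class_p_multiple integral_mult integral_of_nat) (simp add: integral_def)
  finally have "?u \<otimes>\<^bsub>Acyc \<zeta>\<^esub> Z_star_map \<zeta> w = ?u \<otimes>\<^bsub>Acyc \<zeta>\<^esub> \<zero>\<^bsub>Acyc \<zeta>\<^esub>"
    using A.Units_closed[OF u] by simp
  moreover have "Z_star_map \<zeta> w \<in> carrier (Acyc \<zeta>)"
    unfolding Z_star_map_def using terms by (rule A.finsum_closed)
  ultimately show ?thesis
    using A.Units_l_cancel[OF u] by simp
qed

theorem theorem3p8:
  fixes \<zeta> :: "nat \<Rightarrow> complex" and k k' :: "nat list"
  assumes "\<And>p. prime p \<Longrightarrow> primitive_root_of_unity p (\<zeta> p)"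
    and "is_index k" and "k \<noteq> []"
    and "is_index k'" and "k' \<noteq> []"
  shows "Z_star_map \<zeta>
           (star_tilde (word k) (word k') - delta (star_tilde (delta (word k)) (delta (word k'))))
         = \<zero>\<^bsub>Acyc \<zeta>\<^esub>"
proof (rule Z_star_map_eq_0[OF assms(1) negligible_cong])
  \<comment> \<open>As \<open>delta\<close> preserves values, both products approximate the product of the values at \<open>k\<close> and \<open>k'\<close>.\<close>
  let ?E = "\<lambda>w p. Z_eval (\<zeta> p) p w"
  let ?d = "delta (word k)" and ?d' = "delta (word k')"
  have keys: "Poly_Mapping.keys (word k :: H1) \<subseteq> nonempty_indices"
    "Poly_Mapping.keys (word k' :: H1) \<subseteq> nonempty_indices"
    using assms by auto
  show "negligible \<zeta> (\<lambda>p.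
      (?E (star_tilde (word k) (word k')) p - ?E (word k) p * ?E (word k') p) -
      (?E (star_tilde ?d ?d') p - ?E ?d p * ?E ?d' p))"
    by (intro negligible_diff star_tilde_approx keys keys_delta assms(1))
  fix p :: nat assume "prime p"
  note eval_delta = Z_eval_delta[OF assms(1)[OF this]]
  show "(?E (star_tilde (word k) (word k')) p - ?E (word k) p * ?E (word k') p) -
      (?E (star_tilde ?d ?d') p - ?E ?d p * ?E ?d' p) =
    ?E (star_tilde (word k) (word k') - delta (star_tilde ?d ?d')) p"
    by (simp add: rat.eval_minus eval_delta assms(2-5) keys_star_tilde keys_delta del: rat.eval_word)
qed

end
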